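(* Let the constants $d,a,b,c,\beta$ and the initial data $g_0,h_0,u_0,v_0$ (as in the context) be fixed, and let $(u,v,g,h)$ denote the unique global solution of the free boundary problem described in the context with moving parameter $\mu$ for $h$. Then there exists $0<\bar\mu<\sqrt{2da}/K$ such that, whenever $$0<\mu<\bar\mu,\qquad g_0-h_0>\frac{2d\pi}{\sqrt{2da-K^2\mu^2}}=:L(\mu),$$ we have $g(t)\ge K\mu t+h_0+L(\mu)$ for all $t\ge 0$; consequently $g(t)>h(t)$ for all $t\ge 0$ and $g(t)\to\infty$ as $t\to\infty$. Moreover, if $h_0\ge\pi/2$, then $h_\infty=\infty$ for all $\mu>0$.
   Context: Let $a,b,c,d,\beta,\mu>0$ and $0<h_0\le g_0$. Let $u_0\in C^2([0,g_0])$ with $u_0'(0)=0$, $u_0>0$ in $[0,g_0)$, $u_0=0$ in $[g_0,\infty)$, and $v_0\in C^2([0,h_0])$ with $v_0'(0)=0$, $v_0>0$ in $[0,h_0)$, $v_0=0$ in $[h_0,\infty)$. The problem is: $u_t-du_{xx}=u(a-u-bv)$ for $t>0$, $0<x<g(t)$; $v_t-v_{xx}=v(1-v+cu)$ for $t>0$, $0<x<h(t)$; $u_x(t,0)=v_x(t,0)=0$; $g'(t)=-\beta u_x(t,g(t))$, $h'(t)=-\mu v_x(t,h(t))$; $u(t,x)=0$ for $x\ge g(t)$, $v(t,x)=0$ for $x\ge h(t)$; $u(0,\cdot)=u_0$, $v(0,\cdot)=v_0$, $g(0)=g_0$, $h(0)=h_0$. It has a unique global classical solution with $g,h$ increasing;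 $h_\infty=\lim h(t)$. Define $M_1=\max\{a,\|u_0\|_\infty\}$, $M_2=\max\{1+cM_1,\|v_0\|_\infty\}$, and $K=2\max\{M_2\sqrt{(1+cM_1)/2},\,-\min_{[0,h_0]}v_0'\}$. *)

theory Defs
  imports "HOL-Analysis.Analysis"
begin

definition C2_with :: "real set \<Rightarrow> (real \<Rightarrow> real) \<Rightarrow> (real \<Rightarrow> real) \<Rightarrow> (real \<Rightarrow> real) \<Rightarrow> bool" where
  "C2_with S f f' f'' \<longleftrightarrow>
     (\<forall>x\<in>S. (f has_real_derivative f' x) (at x within S)) \<and>
     (\<forall>x\<in>S. (f' has_real_derivative f'' x) (at x within S)) \<and>
     continuous_on S f''"

text \<open>Classical solution (u,v,g,h) of the free boundary problem, with u, v given as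
functions of (t,x) extended by 0 beyond the free boundaries.\<close>
definition fb_solution ::
  "real \<Rightarrow> real \<Rightarrow> real \<Rightarrow> real \<Rightarrow> real \<Rightarrow> real \<Rightarrow> real \<Rightarrow> real \<Rightarrow>
   (real \<Rightarrow> real) \<Rightarrow> (real \<Rightarrow> real) \<Rightarrow>
   (real \<Rightarrow> real \<Rightarrow> real) \<Rightarrow> (real \<Rightarrow> real \<Rightarrow> real) \<Rightarrow> (real \<Rightarrow> real) \<Rightarrow> (real \<Rightarrow> real) \<Rightarrow> bool" where
  "fb_solution d a b c \<beta> \<mu> g0 h0 u0 v0 u v g h \<longleftrightarrow>
     g 0 = g0 \<and> h 0 = h0 \<and>
     continuous_on {0..} g \<and> continuous_on {0..} h \<and>
     (\<forall>t>0. g t > 0 \<and> h t > 0) \<and>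
     continuous_on ({0..} \<times> {0..}) (\<lambda>p. u (fst p) (snd p)) \<and>
     continuous_on ({0..} \<times> {0..}) (\<lambda>p. v (fst p) (snd p)) \<and>
     (\<forall>x\<ge>0. u 0 x = u0 x \<and> v 0 x = v0 x) \<and>
     (\<forall>t\<ge>0. \<forall>x\<ge>g t. u t x = 0) \<and>
     (\<forall>t\<ge>0. \<forall>x\<ge>h t. v t x = 0) \<and>
     (\<exists>ut ux uxx g'. \<forall>t>0.
        (g has_real_derivative g' t) (at t) \<and>
        (\<forall>x\<in>{0..g t}. ((\<lambda>y. u t y) has_real_derivative ux t x) (at x within {0..g t})) \<and>
        (\<forall>x\<in>{0<..<g t}. ((\<lambda>s. u s x) has_real_derivative ut t x) (at t) \<and>
                          (ux t has_real_derivative uxx t x) (at x) \<and>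
                          ut t x - d * uxx t x = u t x * (a - u t x - b * v t x)) \<and>
        ux t 0 = 0 \<and>
        g' t = - \<beta> * ux t (g t)) \<and>
     (\<exists>vt vx vxx h'. \<forall>t>0.
        (h has_real_derivative h' t) (at t) \<and>
        (\<forall>x\<in>{0..h t}. ((\<lambda>y. v t y) has_real_derivative vx t x) (at x within {0..h t})) \<and>
        (\<forall>x\<in>{0<..<h t}. ((\<lambda>s. v s x) has_real_derivative vt t x) (at t) \<and>
                          (vx t has_real_derivative vxx t x) (at x) \<and>
                          vt t x - vxx t x = v t x * (1 - v t x + c * u t x)) \<and>
        vx t 0 = 0 \<and>
        h' t = - \<mu> * vx t (h t))"

end

theory Submission
  imports Defs
begin

text \<open>
  Since \<open>v \<ge> 0\<close> gives \<open>h' \<ge> 0\<close>, the parabola \<open>M2 (2 M s - M\<^sup>2 s\<^sup>2)\<close> with \<open>s = h t - x\<close> and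
  \<open>K = 2 M2 M\<close> dominates \<open>v\<close> near the front, so that \<open>h' \<le> K \<mu>\<close> and \<open>v\<close> vanishes for
  \<open>x \<ge> h0 + K \<mu> t\<close>. There \<open>u\<close> solves a logistic equation and lies above a small bump of width \<open>L \<mu>\<close>
  travelling at speed \<open>K \<mu>\<close>. If \<open>g\<close> met the right end of the bump, the Stefan condition would give
  \<open>g'\<close> a lower bound independent of \<open>\<mu>\<close>, hence \<open>g' > K \<mu>\<close> for small \<open>\<mu>\<close>, which is absurd.

  The species \<open>v\<close> is a supersolution of the logistic equation because \<open>u \<ge> 0\<close>. If \<open>h0 \<ge> pi / 2\<close>, then
  \<open>h\<close> exceeds \<open>pi / 2\<close> at positive times, and a bump whose peak lies in \<open>x > 0\<close> fits into \<open>[0, h t]\<close>.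
  Moving to the right it respects the Neumann condition at \<open>0\<close>, so the same argument with a
  sufficiently slow bump pushes \<open>h\<close> to infinity.
\<close>

lemma filterlim_linear_at_top:
  fixes b c \<sigma> :: real
  assumes "\<sigma> > 0"
  shows "filterlim (\<lambda>t. b + \<sigma> * (t - c)) at_top at_top"
  unfolding filterlim_at_top
proof
  fix Z
  show "eventually (\<lambda>t. Z \<le> b + \<sigma> * (t - c)) at_top"
    using eventually_ge_at_top[of "c + (Z - b) / \<sigma>"]
    by eventually_elim (use assms in \<open>simp add: field_simps\<close>)
qed

lemma second_deriv_nonneg_at_min:
  fixes f f' :: "real \<Rightarrow> real"
  assumes e: "e > 0" and f: "\<And>y. \<bar>y - x\<bar> < e \<Longrightarrow> (f has_real_derivative f' y) (at y)"
    and f': "(f' has_real_derivative f2) (at x)"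
    and min: "\<And>y. \<bar>y - x\<bar> < e \<Longrightarrow> f x \<le> f y"
  shows "f2 \<ge> 0"
proof (rule ccontr)
  assume "\<not> f2 \<ge> 0"
  then obtain r where r: "r > 0" "\<And>h. h > 0 \<Longrightarrow> h < r \<Longrightarrow> f' (x + h) < f' x"
    using DERIV_neg_dec_right[OF f'] by force
  have "f' x = 0"
    using DERIV_local_min[OF f[of x] e] e min by (auto simp: abs_minus_commute)
  define k where "k = min e r / 2"
  have k: "k > 0" "k < e" "k < r" using e r by (auto simp: k_def)
  obtain z where z: "z > x" "z < x + k" "f (x + k) - f x = (x + k - x) * f' z"
    using MVT2[of x "x + k" f f'] f k by auto
  have "f' z < 0" using r(2)[of "z - x"] z k \<open>f' x = 0\<close> by auto
  then have "f (x + k) < f x" using z k mult_pos_neg[of k "f' z"] by simp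
  then show False using min[of "x + k"] k by auto
qed

lemma deriv_nonneg_at_left_end_min:
  fixes f :: "real \<Rightarrow> real"
  assumes f: "(f has_real_derivative m) (at a within {a..b})" and "a < b"
    and min: "\<And>y. y \<in> {a..b} \<Longrightarrow> f a \<le> f y"
  shows "m \<ge> 0"
proof (rule ccontr)
  assume "\<not> m \<ge> 0"
  then obtain r where r: "r > 0" "\<And>h. h > 0 \<Longrightarrow> a + h \<in> {a..b} \<Longrightarrow> h < r \<Longrightarrow> f (a + h) < f a"
    using has_real_derivative_neg_dec_right[OF f] by force
  have "f (a + min r (b - a) / 2) < f a" using r \<open>a < b\<close> by (intro r(2)) (auto simp: min_def field_simps)
  then show False using min[of "a + min r (b - a) / 2"] r \<open>a < b\<close> by (auto simp: min_def field_simps split: if_splits)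
qed

lemma deriv_nonpos_at_right_end_min:
  fixes f :: "real \<Rightarrow> real"
  assumes f: "(f has_real_derivative m) (at b within {a..b})" and "a < b"
    and min: "\<And>y. y \<in> {a..b} \<Longrightarrow> f b \<le> f y"
  shows "m \<le> 0"
proof (rule ccontr)
  assume "\<not> m \<le> 0"
  then obtain r where r: "r > 0" "\<And>h. h > 0 \<Longrightarrow> b - h \<in> {a..b} \<Longrightarrow> h < r \<Longrightarrow> f (b - h) < f b"
    using has_real_derivative_pos_inc_left[OF f] by force
  have "f (b - min r (b - a) / 2) < f b" using r \<open>a < b\<close> by (intro r(2)) (auto simp: min_def field_simps)
  then show False using min[of "b - min r (b - a) / 2"] r \<open>a < b\<close> by (auto simp: min_def field_simps split: if_splits)
qed

definition strip :: "real \<Rightarrow> real \<Rightarrow> (real \<Rightarrow> real) \<Rightarrow> (real \<Rightarrow> real) \<Rightarrow> (real \<times> real) set" where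
  "strip \<tau> T l r = {(t, x). \<tau> \<le> t \<and> t \<le> T \<and> l t \<le> x \<and> x \<le> r t}"

lemma compact_strip:
  assumes l: "continuous_on {\<tau>..T} l" and r: "continuous_on {\<tau>..T} r"
  shows "compact (strip \<tau> T l r)"
proof -
  have "compact (r ` {\<tau>..T})" "compact (l ` {\<tau>..T})"
    using l r by (auto intro: compact_continuous_image)
  then obtain R1 R2 where R: "\<And>t. t \<in> {\<tau>..T} \<Longrightarrow> \<bar>r t\<bar> \<le> R1" "\<And>t. t \<in> {\<tau>..T} \<Longrightarrow> \<bar>l t\<bar> \<le> R2"
    by (force dest!: compact_imp_bounded simp: bounded_iff)
  have R': "r t \<le> R1 \<and> - R2 \<le> l t" if "\<tau> \<le> t" "t \<le> T" for t
    using R[of t] that by (simp add: abs_le_iff)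
  have R'': "p \<in> {\<tau>..T} \<times> {- R2..R1}" if "p \<in> strip \<tau> T l r" for p
    using that R'[of "fst p"] by (auto simp: strip_def)
  have "continuous_on ({\<tau>..T} \<times> {- R2..R1}) (\<lambda>p. l (fst p))"
       "continuous_on ({\<tau>..T} \<times> {- R2..R1}) (\<lambda>p. r (fst p))"
    by (auto intro!: continuous_on_fst continuous_on_id continuous_on_compose2[OF l] continuous_on_compose2[OF r])
  then have "closed {p \<in> {\<tau>..T} \<times> {- R2..R1}. l (fst p) \<le> snd p}"
            "closed {p \<in> {\<tau>..T} \<times> {- R2..R1}. snd p \<le> r (fst p)}"
    by (auto intro!: continuous_on_closed_Collect_le continuous_on_snd continuous_on_id closed_Times)
  then have "compact ({\<tau>..T} \<times> {- R2..R1} \<inter> {p \<in> {\<tau>..T} \<times> {- R2..R1}. l (fst p) \<le> snd p}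
       \<inter> {p \<in> {\<tau>..T} \<times> {- R2..R1}. snd p \<le> r (fst p)})"
    by (intro compact_Int_closed compact_Times) auto
  also have "({\<tau>..T} \<times> {- R2..R1} \<inter> {p \<in> {\<tau>..T} \<times> {- R2..R1}. l (fst p) \<le> snd p}
       \<inter> {p \<in> {\<tau>..T} \<times> {- R2..R1}. snd p \<le> r (fst p)}) = strip \<tau> T l r"
    using R'' by (fastforce simp: strip_def)
  finally show ?thesis .
qed

text \<open>No continuity of the derivatives is available, so the argument looks at a minimum of
  \<open>exp (- (C + 1) t) w + \<epsilon> (R - x)\<close>: the exponential absorbs the zeroth order term, and the
  linear term makes the Neumann condition at the left end strict.\<close>

lemma strip_minimum_principle:
  fixes w wt wx wxx :: "real \<Rightarrow> real \<Rightarrow> real" and l r :: "real \<Rightarrow> real"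
  assumes l: "continuous_on {\<tau>..T} l" and r: "continuous_on {\<tau>..T} r"
    and w: "continuous_on (strip \<tau> T l r) (\<lambda>p. w (fst p) (snd p))" and D: "D \<ge> 0"
    and init: "\<And>x. l \<tau> \<le> x \<Longrightarrow> x \<le> r \<tau> \<Longrightarrow> w \<tau> x \<ge> 0"
    and right: "\<And>t. \<tau> < t \<Longrightarrow> t \<le> T \<Longrightarrow> l t \<le> r t \<Longrightarrow> w t (r t) \<ge> 0"
    and left: "\<And>t. \<tau> < t \<Longrightarrow> t \<le> T \<Longrightarrow> l t < r t \<Longrightarrow> w t (l t) \<ge> 0 \<or>
        (\<exists>m\<le>0. (w t has_real_derivative m) (at (l t) within {l t..r t}))"
    and dx: "\<And>t x. \<tau> < t \<Longrightarrow> t \<le> T \<Longrightarrow> l t < x \<Longrightarrow> x < r t \<Longrightarrow> (w t has_real_derivative wx t x) (at x)"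
    and dxx: "\<And>t x. \<tau> < t \<Longrightarrow> t \<le> T \<Longrightarrow> l t < x \<Longrightarrow> x < r t \<Longrightarrow> (wx t has_real_derivative wxx t x) (at x)"
    and dt: "\<And>t x. \<tau> < t \<Longrightarrow> t \<le> T \<Longrightarrow> l t < x \<Longrightarrow> x < r t \<Longrightarrow> ((\<lambda>s. w s x) has_real_derivative wt t x) (at t)"
    and pde: "\<And>t x. \<tau> < t \<Longrightarrow> t \<le> T \<Longrightarrow> l t < x \<Longrightarrow> x < r t \<Longrightarrow> w t x < 0 \<Longrightarrow>
        wt t x - D * wxx t x \<ge> C * w t x"
    and tx: "\<tau> \<le> t" "t \<le> T" "l t \<le> x" "x \<le> r t"
  shows "w t x \<ge> 0"
proof (rule ccontr)
  assume neg: "\<not> w t x \<ge> 0"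
  let ?S = "strip \<tau> T l r"
  have cS: "compact ?S" by (rule compact_strip[OF l r])
  then obtain R where R: "\<And>p. p \<in> ?S \<Longrightarrow> norm p \<le> R"
    by (meson bounded_iff compact_imp_bounded)
  have R': "y \<le> R" if "(s, y) \<in> ?S" for s y
    using R[OF that] norm_snd_le[of y s] by (auto simp: abs_le_iff)
  define k where "k = C + 1"
  define \<epsilon> where "\<epsilon> = - (exp (- k * t) * w t x) / 2 / (R + 1 - x)"
  have inS: "(t, x) \<in> ?S" using tx by (auto simp: strip_def)
  have Rx: "R + 1 - x > 0" using R'[OF inS] by simp
  have "exp (- k * t) * w t x < 0" using neg by (simp add: mult_less_0_iff)
  then have \<epsilon>: "\<epsilon> > 0" unfolding \<epsilon>_def using Rx by (intro divide_pos_pos) auto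
  define m where "m = (\<lambda>s y. exp (- k * s) * w s y + \<epsilon> * (R + 1 - y))"
  have "continuous_on ?S (\<lambda>p. m (fst p) (snd p))"
    unfolding m_def by (intro continuous_intros w)
  then obtain p where p: "p \<in> ?S" "\<And>q. q \<in> ?S \<Longrightarrow> m (fst p) (snd p) \<le> m (fst q) (snd q)"
    using continuous_attains_inf[OF cS] inS by blast
  obtain s y where sy: "p = (s, y)" by (cases p)
  have min: "m s y \<le> m s' y'" if "(s', y') \<in> ?S" for s' y'
    using p(2)[OF that] sy by simp
  have S: "\<tau> \<le> s" "s \<le> T" "l s \<le> y" "y \<le> r s" using p sy by (auto simp: strip_def)
  have "a / b * b = a" if "b > 0" for a b :: real using that by simp
  from this[OF Rx] have "\<epsilon> * (R + 1 - x) = - (exp (- k * t) * w t x) / 2" unfolding \<epsilon>_def .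
  then have "m t x = exp (- k * t) * w t x / 2" by (simp add: m_def)
  also have "\<dots> < 0" using neg by (simp add: mult_less_0_iff)
  finally have mneg: "m s y < 0" using min[OF inS] by simp
  have "\<epsilon> * (R + 1 - y) > 0" using R'[of s y] p sy \<epsilon> by (intro mult_pos_pos) auto
  then have "exp (- k * s) * w s y < 0" using mneg by (simp add: m_def)
  then have wneg: "w s y < 0" by (simp add: mult_less_0_iff)
  then have s0: "\<tau> < s" using init[of y] S by (cases "s = \<tau>") auto
  have yr: "y < r s" using right[of s] wneg S s0 by (cases "y = r s") auto
  show False
  proof (cases "y = l s")
    case True
    then obtain m' where m': "m' \<le> 0" "(w s has_real_derivative m') (at (l s) within {l s..r s})"
      using left[of s] s0 S yr wneg by auto
    have "(m s has_real_derivative (exp (- k * s) * m' - \<epsilon>)) (at (l s) within {l s..r s})"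
      unfolding m_def by (auto intro!: derivative_eq_intros m')
    then have "exp (- k * s) * m' - \<epsilon> \<ge> 0"
      using yr True S min by (intro deriv_nonneg_at_left_end_min[of "m s"]) (auto simp: strip_def)
    moreover have "exp (- k * s) * m' \<le> 0" using m' by (simp add: mult_nonneg_nonpos)
    ultimately show False using \<epsilon> by simp
  next
    case False
    then have ly: "l s < y" using S by simp
    define e where "e = min (y - l s) (r s - y)"
    have e: "e > 0" using ly yr by (auto simp: e_def)
    have "(m s has_real_derivative (exp (- k * s) * wx s z - \<epsilon>)) (at z)" if "\<bar>z - y\<bar> < e" for z
      unfolding m_def using that s0 S by (auto intro!: derivative_eq_intros dx simp: e_def)
    moreover have "((\<lambda>z. exp (- k * s) * wx s z - \<epsilon>) has_real_derivative exp (- k * s) * wxx s y) (at y)"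
      using ly yr s0 S by (auto intro!: derivative_eq_intros dxx)
    moreover have "m s y \<le> m s z" if "\<bar>z - y\<bar> < e" for z
      using that S by (intro min) (auto simp: strip_def e_def)
    ultimately have "exp (- k * s) * wxx s y \<ge> 0"
      by (rule second_deriv_nonneg_at_min[OF e])
    then have wxx: "wxx s y \<ge> 0" by (simp add: zero_le_mult_iff)
    have "eventually (\<lambda>q. l q < y) (at s within {\<tau>..T})" "eventually (\<lambda>q. y < r q) (at s within {\<tau>..T})"
      using l r ly yr S by (auto simp: continuous_on_def intro: order_tendstoD)
    then have "eventually (\<lambda>q. l q < y \<and> y < r q) (at s within {\<tau>..T})" by (rule eventually_conj)
    then obtain \<rho> where \<rho>: "\<rho> > 0" "\<And>q. q \<in> {\<tau>..T} \<Longrightarrow> q \<noteq> s \<Longrightarrow> dist q s < \<rho> \<Longrightarrow> l q < y \<and> y < r q"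
      unfolding eventually_at by blast
    define a where "a = max \<tau> (s - \<rho> / 2)"
    have a: "a < s" using s0 \<rho> by (auto simp: a_def)
    have "((\<lambda>q. m q y) has_real_derivative (- k * exp (- k * s) * w s y + exp (- k * s) * wt s y)) (at s within {a..s})"
      unfolding m_def using ly yr s0 S
      by (auto intro!: derivative_eq_intros has_field_derivative_at_within[OF dt])
    moreover have "m s y \<le> m q y" if "q \<in> {a..s}" for q
      using that \<rho>(2)[of q] \<rho>(1) S by (cases "q = s") (auto simp: a_def strip_def dist_real_def intro!: min)
    ultimately have "- k * exp (- k * s) * w s y + exp (- k * s) * wt s y \<le> 0"
      using a deriv_nonpos_at_right_end_min by blast
    then have "exp (- k * s) * (wt s y - k * w s y) \<le> 0" by (simp add: algebra_simps)
    then have "wt s y \<le> k * w s y" by (simp add: mult_le_0_iff)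
    moreover have "wt s y - D * wxx s y \<ge> C * w s y" by (rule pde) (use s0 S ly yr wneg in auto)
    moreover have "D * wxx s y \<ge> 0" using D wxx by simp
    ultimately show False using wneg by (simp add: k_def algebra_simps)
  qed
qed

locale fb_species =
  fixes D A B \<kappa> :: real and w q wt wx wxx :: "real \<Rightarrow> real \<Rightarrow> real" and \<eta> \<eta>' :: "real \<Rightarrow> real"
  assumes D_pos: "D > 0" and \<kappa>_pos: "\<kappa> > 0"
    and \<eta>_cont: "continuous_on {0..} \<eta>" and \<eta>_pos: "\<And>t. t \<ge> 0 \<Longrightarrow> \<eta> t > 0"
    and w_cont: "continuous_on ({0..} \<times> {0..}) (\<lambda>p. w (fst p) (snd p))"
    and q_cont: "continuous_on ({0..} \<times> {0..}) (\<lambda>p. q (fst p) (snd p))"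
    and init_nonneg: "\<And>x. x \<ge> 0 \<Longrightarrow> w 0 x \<ge> 0"
    and w_zero: "\<And>t x. t \<ge> 0 \<Longrightarrow> x \<ge> \<eta> t \<Longrightarrow> w t x = 0"
    and \<eta>_deriv: "\<And>t. t > 0 \<Longrightarrow> (\<eta> has_real_derivative \<eta>' t) (at t)"
    and wx_within: "\<And>t x. t > 0 \<Longrightarrow> 0 \<le> x \<Longrightarrow> x \<le> \<eta> t \<Longrightarrow>
          (w t has_real_derivative wx t x) (at x within {0..\<eta> t})"
    and wt: "\<And>t x. t > 0 \<Longrightarrow> 0 < x \<Longrightarrow> x < \<eta> t \<Longrightarrow> ((\<lambda>s. w s x) has_real_derivative wt t x) (at t)"
    and wxx: "\<And>t x. t > 0 \<Longrightarrow> 0 < x \<Longrightarrow> x < \<eta> t \<Longrightarrow> (wx t has_real_derivative wxx t x) (at x)"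
    and pde: "\<And>t x. t > 0 \<Longrightarrow> 0 < x \<Longrightarrow> x < \<eta> t \<Longrightarrow>
          wt t x - D * wxx t x = w t x * (A - w t x - B * q t x)"
    and neumann: "\<And>t. t > 0 \<Longrightarrow> wx t 0 = 0"
    and stefan: "\<And>t. t > 0 \<Longrightarrow> \<eta>' t = - \<kappa> * wx t (\<eta> t)"
begin

lemma wx_at:
  assumes "t > 0" "0 < x" "x < \<eta> t"
  shows "(w t has_real_derivative wx t x) (at x)"
  using wx_within[of t x] assms by (simp add: at_within_Icc_at)

lemma \<eta>_cont_on: "0 \<le> \<tau> \<Longrightarrow> continuous_on {\<tau>..T} \<eta>"
  by (rule continuous_on_subset[OF \<eta>_cont]) auto

text \<open>With \<open>\<sigma> = 1\<close> this compares with subsolutions, with \<open>\<sigma> = -1\<close> with supersolutions.\<close>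

lemma comparison:
  fixes z zt zx zxx :: "real \<Rightarrow> real \<Rightarrow> real"
  assumes \<tau>: "0 \<le> \<tau>"
    and l: "continuous_on {\<tau>..T} l" and r: "continuous_on {\<tau>..T} r"
    and lr: "\<And>t. \<tau> \<le> t \<Longrightarrow> t \<le> T \<Longrightarrow> 0 \<le> l t \<and> r t \<le> \<eta> t"
    and z: "continuous_on (strip \<tau> T l r) (\<lambda>p. z (fst p) (snd p))"
    and zx: "\<And>t x. \<tau> < t \<Longrightarrow> (z t has_real_derivative zx t x) (at x)"
    and zxx: "\<And>t x. \<tau> < t \<Longrightarrow> (zx t has_real_derivative zxx t x) (at x)"
    and zt: "\<And>t x. \<tau> < t \<Longrightarrow> ((\<lambda>s. z s x) has_real_derivative zt t x) (at t)"
    and init: "\<And>x. l \<tau> \<le> x \<Longrightarrow> x \<le> r \<tau> \<Longrightarrow> \<sigma> * (w \<tau> x - z \<tau> x) \<ge> 0"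
    and right: "\<And>t. \<tau> < t \<Longrightarrow> t \<le> T \<Longrightarrow> l t \<le> r t \<Longrightarrow> \<sigma> * (w t (r t) - z t (r t)) \<ge> 0"
    and left: "\<And>t. \<tau> < t \<Longrightarrow> t \<le> T \<Longrightarrow> l t < r t \<Longrightarrow> \<sigma> * (w t (l t) - z t (l t)) \<ge> 0 \<or>
        l t = 0 \<and> \<sigma> * zx t 0 \<ge> 0"
    and sub: "\<And>t x. \<tau> < t \<Longrightarrow> t \<le> T \<Longrightarrow> l t < x \<Longrightarrow> x < r t \<Longrightarrow> \<sigma> * (w t x - z t x) < 0 \<Longrightarrow>
        \<sigma> * (w t x * (A - w t x - B * q t x) - (zt t x - D * zxx t x)) \<ge> C * (\<sigma> * (w t x - z t x))"
    and tx: "\<tau> \<le> t" "t \<le> T" "l t \<le> x" "x \<le> r t"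
  shows "\<sigma> * (w t x - z t x) \<ge> 0"
proof -
  have S: "strip \<tau> T l r \<subseteq> {0..} \<times> {0..}" using lr \<tau> by (force simp: strip_def)
  show ?thesis
  proof (rule strip_minimum_principle[where w = "\<lambda>t x. \<sigma> * (w t x - z t x)" and D = D and C = C
        and wt = "\<lambda>t x. \<sigma> * (wt t x - zt t x)" and wx = "\<lambda>t x. \<sigma> * (wx t x - zx t x)"
        and wxx = "\<lambda>t x. \<sigma> * (wxx t x - zxx t x)", OF l r _ _ init right _ _ _ _ _ tx])
    show "continuous_on (strip \<tau> T l r) (\<lambda>p. \<sigma> * (w (fst p) (snd p) - z (fst p) (snd p)))"
      by (intro continuous_intros z continuous_on_subset[OF w_cont S])
    show "0 \<le> D" using D_pos by simp
  next
    fix t assume t: "\<tau> < t" "t \<le> T" "l t < r t"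
    have "\<exists>m\<le>0. ((\<lambda>x. \<sigma> * (w t x - z t x)) has_real_derivative m) (at (l t) within {l t..r t})"
      if *: "l t = 0" "\<sigma> * zx t 0 \<ge> 0"
    proof (intro exI conjI)
      show "\<sigma> * (wx t 0 - zx t 0) \<le> 0" using * neumann[of t] t \<tau> by simp
      have "(w t has_real_derivative wx t 0) (at 0 within {0..r t})"
        using lr[of t] t \<tau> * by (intro DERIV_subset[OF wx_within]) auto
      then show "((\<lambda>x. \<sigma> * (w t x - z t x)) has_real_derivative \<sigma> * (wx t 0 - zx t 0)) (at (l t) within {l t..r t})"
        using t * by (auto intro!: derivative_eq_intros has_field_derivative_at_within[OF zx])
    qed
    then show "0 \<le> \<sigma> * (w t (l t) - z t (l t)) \<or>
        (\<exists>m\<le>0. ((\<lambda>x. \<sigma> * (w t x - z t x)) has_real_derivative m) (at (l t) within {l t..r t}))"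
      using left[OF t] by blast
  next
    fix t x assume t: "\<tau> < t" "t \<le> T" "l t < x" "x < r t"
    then have t': "0 < t" "0 < x" "x < \<eta> t" using lr[of t] \<tau> by auto
    show "((\<lambda>x. \<sigma> * (w t x - z t x)) has_real_derivative \<sigma> * (wx t x - zx t x)) (at x)"
      "((\<lambda>x. \<sigma> * (wx t x - zx t x)) has_real_derivative \<sigma> * (wxx t x - zxx t x)) (at x)"
      "((\<lambda>s. \<sigma> * (w s x - z s x)) has_real_derivative \<sigma> * (wt t x - zt t x)) (at t)"
      using t t' by (auto intro!: derivative_eq_intros wx_at wxx wt zx zxx zt)
    assume "\<sigma> * (w t x - z t x) < 0"
    from sub[OF t this, folded pde[OF t']]
    show "C * (\<sigma> * (w t x - z t x)) \<le> \<sigma> * (wt t x - zt t x) - D * (\<sigma> * (wxx t x - zxx t x))"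
      by (simp add: algebra_simps)
  qed auto
qed

lemma nonneg:
  assumes "t \<ge> 0" "x \<ge> 0"
  shows "w t x \<ge> 0"
proof (cases "x \<le> \<eta> t")
  case True
  have S: "strip 0 t (\<lambda>_. 0) \<eta> \<subseteq> {0..} \<times> {0..}" by (auto simp: strip_def)
  have "compact ((\<lambda>p. A - w (fst p) (snd p) - B * q (fst p) (snd p)) ` strip 0 t (\<lambda>_. 0) \<eta>)"
    by (intro compact_continuous_image compact_strip continuous_intros \<eta>_cont_on
        continuous_on_subset[OF w_cont S] continuous_on_subset[OF q_cont S]) auto
  then obtain C where C: "\<And>p. p \<in> strip 0 t (\<lambda>_. 0) \<eta> \<Longrightarrow> A - w (fst p) (snd p) - B * q (fst p) (snd p) \<le> C"
    by (force dest!: compact_imp_bounded simp: bounded_iff abs_le_iff)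
  have "1 * (w t x - 0) \<ge> 0"
  proof (rule comparison[where z = "\<lambda>_ _. 0" and zt = "\<lambda>_ _. 0" and zx = "\<lambda>_ _. 0" and zxx = "\<lambda>_ _. 0" and
        \<sigma> = 1 and \<tau> = 0 and T = t and l = "\<lambda>_. 0" and r = \<eta> and C = C])
    show "continuous_on {0..t} \<eta>" by (rule \<eta>_cont_on) simp
  next
    fix s y assume s: "0 < s" "s \<le> t" "0 < y" "y < \<eta> s" "1 * (w s y - 0) < 0"
    then have "A - w s y - B * q s y \<le> C" using C[of "(s, y)"] by (auto simp: strip_def)
    then have "C * w s y \<le> (A - w s y - B * q s y) * w s y"
      using s by (intro mult_right_mono_neg) auto
    then show "C * (1 * (w s y - 0)) \<le> 1 * (w s y * (A - w s y - B * q s y) - (0 - D * 0))"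
      by (simp add: algebra_simps)
  qed (use assms True init_nonneg w_zero in auto)
  then show ?thesis by simp
qed (use w_zero assms in auto)

lemma le_bound:
  assumes M: "M \<ge> 0" "\<And>x. x \<ge> 0 \<Longrightarrow> w 0 x \<le> M"
    and AB: "\<And>t x. t \<ge> 0 \<Longrightarrow> x \<ge> 0 \<Longrightarrow> A - B * q t x \<le> M"
    and tx: "t \<ge> 0" "x \<ge> 0"
  shows "w t x \<le> M"
proof (cases "x \<le> \<eta> t")
  case True
  have "-1 * (w t x - M) \<ge> 0"
  proof (rule comparison[where z = "\<lambda>_ _. M" and zt = "\<lambda>_ _. 0" and zx = "\<lambda>_ _. 0" and zxx = "\<lambda>_ _. 0" and
        \<sigma> = "-1" and \<tau> = 0 and T = t and l = "\<lambda>_. 0" and r = \<eta> and C = 0])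
    show "continuous_on {0..t} \<eta>" by (rule \<eta>_cont_on) simp
  next
    fix s y assume s: "0 < s" "s \<le> t" "0 < y" "y < \<eta> s" "-1 * (w s y - M) < 0"
    then have "w s y * (A - w s y - B * q s y) \<le> 0"
      using AB[of s y] M by (intro mult_nonneg_nonpos) auto
    then show "0 * (-1 * (w s y - M)) \<le> -1 * (w s y * (A - w s y - B * q s y) - (0 - D * 0))"
      by simp
  qed (use tx True M w_zero in auto)
  then show ?thesis by simp
qed (use w_zero tx M in auto)

lemma \<eta>'_nonneg:
  assumes "t > 0"
  shows "\<eta>' t \<ge> 0"
proof -
  have "wx t (\<eta> t) \<le> 0"
  proof (rule deriv_nonpos_at_right_end_min)
    show "(w t has_real_derivative wx t (\<eta> t)) (at (\<eta> t) within {0..\<eta> t})"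
      using assms \<eta>_pos[of t] by (intro wx_within) auto
    show "0 < \<eta> t" using \<eta>_pos assms by simp
  qed (use assms nonneg w_zero in auto)
  then show ?thesis using stefan[OF assms] \<kappa>_pos by (simp add: mult_nonneg_nonpos)
qed

lemma \<eta>_mono:
  assumes "0 \<le> s" "s \<le> t"
  shows "\<eta> s \<le> \<eta> t"
proof (cases "s = t")
  case False
  show ?thesis
  proof (rule DERIV_nonneg_imp_increasing_open[OF assms(2)])
    show "continuous_on {s..t} \<eta>" using assms by (intro \<eta>_cont_on)
    show "\<exists>y. (\<eta> has_real_derivative y) (at x) \<and> 0 \<le> y" if "s < x" "x < t" for x
      using \<eta>_deriv[of x] \<eta>'_nonneg[of x] that assms by auto
  qed
qed simp

lemma \<eta>'_le:
  assumes P: "P > 0" "\<And>t x. t \<ge> 0 \<Longrightarrow> x \<ge> 0 \<Longrightarrow> w t x \<le> P"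
    and N: "N \<ge> 0" "\<And>t x. t \<ge> 0 \<Longrightarrow> x \<ge> 0 \<Longrightarrow> A - B * q t x \<le> N"
    and M: "M > 0" "2 * D * M\<^sup>2 \<ge> N"
    and init: "\<And>x. 0 \<le> x \<Longrightarrow> x \<le> \<eta> 0 \<Longrightarrow> w 0 x \<le> P * M * (\<eta> 0 - x)"
    and t: "t > 0"
  shows "\<eta>' t \<le> \<kappa> * (2 * P * M)"
proof -
  define l where "l = (\<lambda>s. max 0 (\<eta> s - 1 / M))"
  define z where "z = (\<lambda>s x. P * (2 * M * (\<eta> s - x) - M\<^sup>2 * (\<eta> s - x)\<^sup>2))"
  have l_less: "l s < \<eta> s" if "s \<ge> 0" for s using \<eta>_pos[OF that] M by (simp add: l_def)
  have le: "w t x \<le> z t x" if x: "l t \<le> x" "x \<le> \<eta> t" for x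
  proof -
    have "-1 * (w t x - z t x) \<ge> 0"
    proof (rule comparison[where z = z and zt = "\<lambda>s x. P * (2 * M * \<eta>' s - M\<^sup>2 * 2 * (\<eta> s - x) * \<eta>' s)"
        and zx = "\<lambda>s x. P * (- 2 * M + M\<^sup>2 * 2 * (\<eta> s - x))" and zxx = "\<lambda>s x. - P * M\<^sup>2 * 2" and
        \<sigma> = "-1" and \<tau> = 0 and T = t and l = l and r = \<eta> and C = 0])
      show "continuous_on {0..t} \<eta>" by (rule \<eta>_cont_on) simp
      then show "continuous_on {0..t} l" unfolding l_def by (intro continuous_intros)
      show "continuous_on (strip 0 t l \<eta>) (\<lambda>p. z (fst p) (snd p))"
        unfolding z_def by (intro continuous_intros continuous_on_compose2[OF \<eta>_cont]) (auto simp: strip_def)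
      show "(z s has_real_derivative P * (- 2 * M + M\<^sup>2 * 2 * (\<eta> s - x))) (at x)" for s x
        unfolding z_def by (auto intro!: derivative_eq_intros simp: algebra_simps)
      show "((\<lambda>x. P * (- 2 * M + M\<^sup>2 * 2 * (\<eta> s - x))) has_real_derivative - P * M\<^sup>2 * 2) (at x)" for s x
        by (auto intro!: derivative_eq_intros simp: algebra_simps)
      show "((\<lambda>s. z s x) has_real_derivative P * (2 * M * \<eta>' s - M\<^sup>2 * 2 * (\<eta> s - x) * \<eta>' s)) (at s)"
        if "0 < s" for s x
        unfolding z_def using \<eta>_deriv[OF that] by (auto intro!: derivative_eq_intros simp: algebra_simps)
    next
      fix x assume x: "l 0 \<le> x" "x \<le> \<eta> 0"
      have "\<eta> 0 - x \<le> 1 / M" using x by (simp add: l_def)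
      then have "M * (\<eta> 0 - x) \<le> 1" using M by (simp add: field_simps)
      then have "P * M * (\<eta> 0 - x) * 1 \<le> P * M * (\<eta> 0 - x) * (2 - M * (\<eta> 0 - x))"
        using x P M by (intro mult_left_mono mult_nonneg_nonneg) auto
      also have "\<dots> = z 0 x" by (simp add: z_def algebra_simps power2_eq_square)
      finally show "-1 * (w 0 x - z 0 x) \<ge> 0" using init[of x] x by (simp add: l_def)
    next
      fix s assume s: "0 < s" "s \<le> t" "l s < \<eta> s"
      show "-1 * (w s (l s) - z s (l s)) \<ge> 0 \<or> l s = 0 \<and> -1 * (P * (- 2 * M + M\<^sup>2 * 2 * (\<eta> s - 0))) \<ge> 0"
      proof (cases "\<eta> s - 1 / M \<ge> 0")
        case True
        then have "z s (l s) = P" using M by (simp add: l_def z_def power2_eq_square)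
        then show ?thesis using P(2)[of s "l s"] s by (simp add: l_def)
      next
        case False
        then have "M * \<eta> s \<le> 1" using M by (simp add: field_simps)
        then have "P * M * 2 * (M * \<eta> s) \<le> P * M * 2 * 1" using P M by (intro mult_left_mono) auto
        then have "-1 * (P * (- 2 * M + M\<^sup>2 * 2 * (\<eta> s - 0))) \<ge> 0" by (simp add: algebra_simps power2_eq_square)
        then show ?thesis using False by (simp add: l_def)
      qed
    next
      fix s x assume s: "0 < s" "s \<le> t" "l s < x" "x < \<eta> s"
      then have x0: "x \<ge> 0" by (simp add: l_def)
      have "\<eta> s - x \<le> 1 / M" using s by (simp add: l_def)
      then have "M * (\<eta> s - x) \<le> 1" using M by (simp add: field_simps)
      then have "P * M * 2 * \<eta>' s * (M * (\<eta> s - x)) \<le> P * M * 2 * \<eta>' s * 1"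
        using P M \<eta>'_nonneg[OF s(1)] by (intro mult_left_mono) auto
      then have 1: "P * (2 * M * \<eta>' s - M\<^sup>2 * 2 * (\<eta> s - x) * \<eta>' s) \<ge> 0"
        by (simp add: algebra_simps power2_eq_square)
      have "w s x * (A - w s x - B * q s x) \<le> w s x * N"
        using N(2)[of s x] nonneg[of s x] s x0 by (intro mult_left_mono) auto
      also have "\<dots> \<le> P * (2 * D * M\<^sup>2)"
        using P(2)[of s x] P(1) s x0 N(1) M by (intro mult_mono) auto
      finally show "0 * (-1 * (w s x - z s x)) \<le> -1 * (w s x * (A - w s x - B * q s x) -
          (P * (2 * M * \<eta>' s - M\<^sup>2 * 2 * (\<eta> s - x) * \<eta>' s) - D * (- P * M\<^sup>2 * 2)))"
        using 1 by (simp add: algebra_simps)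
    qed (use t x w_zero in \<open>auto simp: l_def z_def\<close>)
    then show ?thesis by simp
  qed
  have "- (2 * P * M) - wx t (\<eta> t) \<le> 0"
  proof (rule deriv_nonpos_at_right_end_min[of "\<lambda>x. z t x - w t x" _ _ "l t"])
    have "(w t has_real_derivative wx t (\<eta> t)) (at (\<eta> t) within {l t..\<eta> t})"
      using t \<eta>_pos[of t] by (intro DERIV_subset[OF wx_within]) (auto simp: l_def)
    then show "((\<lambda>x. z t x - w t x) has_real_derivative - (2 * P * M) - wx t (\<eta> t)) (at (\<eta> t) within {l t..\<eta> t})"
      unfolding z_def by (auto intro!: derivative_eq_intros)
    show "l t < \<eta> t" using l_less t by simp
    show "z t (\<eta> t) - w t (\<eta> t) \<le> z t y - w t y" if "y \<in> {l t..\<eta> t}" for y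
      using le[of y] that w_zero[of t "\<eta> t"] t by (simp add: z_def)
  qed
  then have "\<kappa> * (- wx t (\<eta> t)) \<le> \<kappa> * (2 * P * M)" using \<kappa>_pos by (intro mult_left_mono) auto
  then show ?thesis using stefan[OF t] by simp
qed

lemma \<eta>_le_linear:
  assumes "\<And>t. t > 0 \<Longrightarrow> \<eta>' t \<le> S" and "t \<ge> 0"
  shows "\<eta> t \<le> \<eta> 0 + S * t"
proof -
  have "\<eta> t - S * t \<le> \<eta> 0 - S * 0"
  proof (rule DERIV_nonpos_imp_decreasing_open[OF assms(2)])
    show "\<exists>y. ((\<lambda>t. \<eta> t - S * t) has_real_derivative y) (at x) \<and> y \<le> 0" if "0 < x" for x
      using \<eta>_deriv[OF that] assms(1)[OF that]
      by (intro exI[of _ "\<eta>' x - S"]) (auto intro!: derivative_eq_intros)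
    show "continuous_on {0..t} (\<lambda>t. \<eta> t - S * t)" by (intro continuous_intros \<eta>_cont_on) simp
  qed
  then show ?thesis by simp
qed

lemma wx_le_at_front:
  assumes t: "t > 0" and a: "0 \<le> a" "a < \<eta> t"
    and z: "(z has_real_derivative m) (at (\<eta> t))" "z (\<eta> t) = 0"
    and le: "\<And>x. a \<le> x \<Longrightarrow> x \<le> \<eta> t \<Longrightarrow> z x \<le> w t x"
  shows "wx t (\<eta> t) \<le> m"
proof -
  have "wx t (\<eta> t) - m \<le> 0"
  proof (rule deriv_nonpos_at_right_end_min[of "\<lambda>x. w t x - z x" _ _ a])
    have "(w t has_real_derivative wx t (\<eta> t)) (at (\<eta> t) within {a..\<eta> t})"
      using t a by (intro DERIV_subset[OF wx_within]) auto
    then show "((\<lambda>x. w t x - z x) has_real_derivative wx t (\<eta> t) - m) (at (\<eta> t) within {a..\<eta> t})"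
      by (intro DERIV_diff has_field_derivative_at_within[OF z(1)])
  qed (use a le z(2) w_zero[of t "\<eta> t"] t in auto)
  then show ?thesis by simp
qed

text \<open>The bump \<open>\<delta> exp (- \<sigma> \<xi> / (2 D)) sin (\<omega> \<xi>)\<close> with \<open>\<xi> = x - a - \<sigma> (t - \<tau>)\<close> is a subsolution
  travelling at speed \<open>\<sigma>\<close>. When the free boundary first meets its right end, the Stefan condition
  forces the free boundary to move faster than the bump.\<close>

lemma front_bound:
  assumes \<tau>: "0 \<le> \<tau>" and \<omega>: "\<omega> > 0" and \<sigma>: "\<sigma> > 0" and \<delta>: "\<delta> > 0"
    and apos: "a + pi / \<omega> > 0" and start: "a + pi / \<omega> < \<eta> \<tau>"
    and init: "\<And>x. 0 \<le> x \<Longrightarrow> a \<le> x \<Longrightarrow> x \<le> a + pi / \<omega> \<Longrightarrow> \<delta> \<le> w \<tau> x"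
    and reac: "\<And>t x. \<tau> < t \<Longrightarrow> 0 < x \<Longrightarrow> a + \<sigma> * (t - \<tau>) < x \<Longrightarrow> x < \<eta> t \<Longrightarrow> G \<le> A - B * q t x"
    and G: "D * \<omega>\<^sup>2 + \<sigma>\<^sup>2 / (4 * D) + \<delta> \<le> G"
    and slope: "\<And>\<xi>. 0 \<le> \<xi> \<Longrightarrow> \<xi> \<le> - a \<Longrightarrow> \<sigma> / (2 * D) * sin (\<omega> * \<xi>) \<le> \<omega> * cos (\<omega> * \<xi>)"
    and speed: "\<sigma> < \<kappa> * (\<delta> * \<omega> * exp (- (\<sigma> / (2 * D)) * (pi / \<omega>)))"
    and t: "\<tau> \<le> t"
  shows "a + pi / \<omega> + \<sigma> * (t - \<tau>) < \<eta> t"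
proof (rule ccontr)
  assume neg: "\<not> ?thesis"
  define r where "r = (\<lambda>s. a + pi / \<omega> + \<sigma> * (s - \<tau>))"
  define f where "f = (\<lambda>s. \<eta> s - r s)"
  have cont_f: "continuous_on {\<tau>..T} f" for T
    unfolding f_def r_def by (intro continuous_intros \<eta>_cont_on \<tau>)
  have "closed {s \<in> {\<tau>..t}. f s \<le> 0}"
    by (rule continuous_on_closed_Collect_le[OF cont_f]) auto
  moreover have "bounded {s \<in> {\<tau>..t}. f s \<le> 0}" by (rule bounded_subset[of "{\<tau>..t}"]) auto
  ultimately have "compact {s \<in> {\<tau>..t}. f s \<le> 0}" by (simp add: compact_eq_bounded_closed)
  moreover have "t \<in> {s \<in> {\<tau>..t}. f s \<le> 0}" using neg t by (simp add: f_def r_def)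
  ultimately obtain T where T: "\<tau> \<le> T" "T \<le> t" "f T \<le> 0"
    and T_min: "\<And>s. \<tau> \<le> s \<Longrightarrow> s \<le> t \<Longrightarrow> f s \<le> 0 \<Longrightarrow> T \<le> s"
    using compact_attains_inf[of "{s \<in> {\<tau>..t}. f s \<le> 0}"] by auto
  have "f \<tau> > 0" using start by (simp add: f_def r_def)
  then have T0: "\<tau> < T" using T by (cases "T = \<tau>") auto
  have "\<exists>s\<ge>\<tau>. s \<le> T \<and> f s = 0"
    using T \<open>f \<tau> > 0\<close> cont_f by (intro IVT2') auto
  then have fT: "f T = 0" using T_min T by force
  have f_nonneg: "f s \<ge> 0" if "\<tau> \<le> s" "s \<le> T" for s
    using T_min[of s] that T fT by (smt (verit))
  define \<alpha> where "\<alpha> = \<sigma> / (2 * D)"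
  define \<xi> where "\<xi> = (\<lambda>s x. x - a - \<sigma> * (s - \<tau>))"
  define z where "z = (\<lambda>s x. \<delta> * (exp (- \<alpha> * \<xi> s x) * sin (\<omega> * \<xi> s x)))"
  define zx where "zx = (\<lambda>s x. \<delta> * (exp (- \<alpha> * \<xi> s x) * (\<omega> * cos (\<omega> * \<xi> s x) - \<alpha> * sin (\<omega> * \<xi> s x))))"
  define zxx where "zxx = (\<lambda>s x. \<delta> * (exp (- \<alpha> * \<xi> s x) *
      ((\<alpha>\<^sup>2 - \<omega>\<^sup>2) * sin (\<omega> * \<xi> s x) - 2 * \<alpha> * \<omega> * cos (\<omega> * \<xi> s x))))"
  define E where "E = D * \<omega>\<^sup>2 + \<sigma>\<^sup>2 / (4 * D)"
  define l where "l = (\<lambda>s. max 0 (a + \<sigma> * (s - \<tau>)))"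
  have z_zx: "(z s has_real_derivative zx s x) (at x)" for s x
    unfolding z_def zx_def \<xi>_def by (auto intro!: derivative_eq_intros simp: algebra_simps)
  have zx_zxx: "(zx s has_real_derivative zxx s x) (at x)" for s x
    unfolding zx_def zxx_def \<xi>_def by (auto intro!: derivative_eq_intros simp: algebra_simps power2_eq_square)
  have z_zt: "((\<lambda>s. z s x) has_real_derivative - \<sigma> * zx s x) (at s)" for s x
    unfolding z_def zx_def \<xi>_def by (auto intro!: derivative_eq_intros simp: algebra_simps)
  have \<sigma>\<alpha>: "\<sigma> = 2 * D * \<alpha>" using D_pos by (simp add: \<alpha>_def)
  then have E\<alpha>: "E = D * \<omega>\<^sup>2 + D * \<alpha>\<^sup>2" using D_pos by (simp add: E_def power2_eq_square)
  have z_eq: "- \<sigma> * zx s x - D * zxx s x = E * z s x" for s x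
    unfolding zx_def zxx_def z_def E\<alpha> \<sigma>\<alpha> by (simp add: algebra_simps power2_eq_square)
  have \<alpha>0: "\<alpha> > 0" using D_pos \<sigma> by (simp add: \<alpha>_def)
  have z_bounds: "0 \<le> z s x \<and> z s x \<le> \<delta>" if "l s \<le> x" "x \<le> r s" for s x
  proof -
    have \<xi>: "0 \<le> \<xi> s x" "\<xi> s x \<le> pi / \<omega>" using that by (auto simp: \<xi>_def l_def r_def)
    then have "\<omega> * \<xi> s x \<le> pi" using \<omega> by (simp add: field_simps)
    then have sn: "0 \<le> sin (\<omega> * \<xi> s x)" using \<xi> \<omega> by (intro sin_ge_zero) auto
    have "exp (- \<alpha> * \<xi> s x) * sin (\<omega> * \<xi> s x) \<le> 1 * 1"
      using \<xi> \<alpha>0 sn by (intro mult_mono) auto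
    then have "z s x \<le> \<delta> * 1" unfolding z_def using \<delta> by (intro mult_left_mono) auto
    then show ?thesis using sn \<delta> by (simp add: z_def)
  qed
  have z_right: "z s (r s) = 0" for s using \<omega> by (simp add: z_def \<xi>_def r_def)
  have r_pos: "r s > 0" if "\<tau> \<le> s" for s using apos \<sigma> that by (simp add: r_def add_pos_nonneg)
  have lr: "l s < r s" if "\<tau> \<le> s" for s using r_pos[OF that] \<omega> by (auto simp: l_def r_def)
  have le: "z T x \<le> w T x" if x: "l T \<le> x" "x \<le> r T" for x
  proof -
    have "1 * (w T x - z T x) \<ge> 0"
    proof (rule comparison[where z = z and zt = "\<lambda>s x. - \<sigma> * zx s x" and zx = zx and zxx = zxx and
          \<sigma> = 1 and \<tau> = \<tau> and T = T and l = l and r = r and C = E])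
      show "continuous_on {\<tau>..T} l" "continuous_on {\<tau>..T} r"
        unfolding l_def r_def by (intro continuous_intros)+
      show "continuous_on (strip \<tau> T l r) (\<lambda>p. z (fst p) (snd p))"
        unfolding z_def \<xi>_def by (intro continuous_intros)
      show "0 \<le> l s \<and> r s \<le> \<eta> s" if "\<tau> \<le> s" "s \<le> T" for s
        using f_nonneg[OF that] by (simp add: l_def f_def)
      show "1 * (w \<tau> x - z \<tau> x) \<ge> 0" if "l \<tau> \<le> x" "x \<le> r \<tau>" for x
        using z_bounds[OF that] init[of x] that by (simp add: l_def r_def)
      show "1 * (w s (r s) - z s (r s)) \<ge> 0" if "\<tau> < s" for s
        using z_right nonneg[of s "r s"] r_pos[of s] that \<tau> by simp
      show "1 * (w s (l s) - z s (l s)) \<ge> 0 \<or> l s = 0 \<and> 1 * zx s 0 \<ge> 0" if s: "\<tau> < s" for s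
      proof (cases "a + \<sigma> * (s - \<tau>) \<ge> 0")
        case True
        then have "z s (l s) = 0" by (simp add: z_def \<xi>_def l_def)
        then show ?thesis using nonneg[of s "l s"] s \<tau> by (simp add: l_def)
      next
        case False
        have "\<sigma> * (s - \<tau>) \<ge> 0" using \<sigma> s by simp
        then have "\<alpha> * sin (\<omega> * \<xi> s 0) \<le> \<omega> * cos (\<omega> * \<xi> s 0)"
          unfolding \<alpha>_def using False by (intro slope) (auto simp: \<xi>_def)
        then show ?thesis using \<delta> False by (simp add: zx_def l_def)
      qed
    next
      fix s x assume s: "\<tau> < s" "s \<le> T" "l s < x" "x < r s" "1 * (w s x - z s x) < 0"
      then have x: "x > 0" "x < \<eta> s" using f_nonneg[of s] by (auto simp: l_def f_def)
      have w: "w s x \<ge> 0" "w s x \<le> \<delta>" using nonneg[of s x] z_bounds[of s x] s x \<tau> by auto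
      have "G \<le> A - B * q s x" using s x by (intro reac) (auto simp: l_def)
      then have "w s x * E \<le> w s x * (A - w s x - B * q s x)"
        using w G by (intro mult_left_mono) (auto simp: E_def)
      then show "E * (1 * (w s x - z s x)) \<le> 1 * (w s x * (A - w s x - B * q s x) - (- \<sigma> * zx s x - D * zxx s x))"
        unfolding z_eq by (simp add: algebra_simps)
    qed (use \<tau> T x z_zx zx_zxx z_zt in auto)
    then show ?thesis by simp
  qed
  have \<eta>T: "\<eta> T = r T" using fT by (simp add: f_def)
  have "wx T (\<eta> T) \<le> zx T (\<eta> T)"
    using T0 \<tau> lr[of T] z_zx le z_right by (intro wx_le_at_front[of T "l T" "z T"]) (auto simp: \<eta>T l_def)
  also have "zx T (\<eta> T) = - (\<delta> * \<omega> * exp (- \<alpha> * (pi / \<omega>)))"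
    using \<omega> by (simp add: zx_def \<eta>T \<xi>_def r_def)
  finally have "\<kappa> * (\<delta> * \<omega> * exp (- \<alpha> * (pi / \<omega>))) \<le> \<kappa> * (- wx T (\<eta> T))"
    using \<kappa>_pos by (intro mult_left_mono) auto
  then have "\<sigma> < \<eta>' T" using speed stefan[of T] T0 \<tau> by (simp add: \<alpha>_def)
  moreover have "\<eta>' T - \<sigma> \<le> 0"
  proof (rule deriv_nonpos_at_right_end_min[of f])
    have "(\<eta> has_real_derivative \<eta>' T) (at T within {\<tau>..T})"
      using \<eta>_deriv[of T] T0 \<tau> by (auto intro: has_field_derivative_at_within)
    then show "(f has_real_derivative \<eta>' T - \<sigma>) (at T within {\<tau>..T})"
      unfolding f_def r_def by (auto intro!: derivative_eq_intros)
  qed (use T0 fT f_nonneg in auto)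
  ultimately show False by simp
qed

text \<open>In the barrier \<open>\<delta> exp (- k (t - \<tau>)) (y + \<alpha> y\<^sup>2)\<close> with \<open>y = (\<rho> t)\<^sup>2 - x\<^sup>2\<close>, the quadratic term
  provides enough convexity near the moving end \<open>\<rho>\<close> to pay for its motion; away from the end the
  decay rate \<open>k\<close> does.\<close>

lemma positivity_spreads:
  assumes \<tau>: "0 \<le> \<tau>" "\<tau> < T" and r0: "0 < r0" "r0 \<le> r" "r \<le> \<eta> \<tau>"
    and init: "\<And>x. 0 \<le> x \<Longrightarrow> x \<le> r0 \<Longrightarrow> w \<tau> x > 0"
    and G: "G > 0" "\<And>t x. 0 \<le> t \<Longrightarrow> 0 \<le> x \<Longrightarrow> G \<le> A - B * q t x"
  shows "\<exists>m>0. \<forall>x\<in>{0..r}. m * (r\<^sup>2 - x\<^sup>2) \<le> w T x"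
proof -
  define \<sigma> where "\<sigma> = (r - r0) / (T - \<tau>)"
  define \<rho> where "\<rho> = (\<lambda>s. r0 + \<sigma> * (s - \<tau>))"
  define P where "P = 2 * r * \<sigma> + 2 * D"
  define \<alpha> where "\<alpha> = P / (8 * D * r0\<^sup>2)"
  define k where "k = 2 * \<alpha> * P + 8 * D * \<alpha>"
  have \<sigma>: "\<sigma> \<ge> 0" using \<tau> r0 by (simp add: \<sigma>_def)
  have P: "P > 0" using \<sigma> D_pos r0 by (simp add: P_def add_nonneg_pos)
  have \<alpha>: "\<alpha> > 0" using P D_pos r0 by (simp add: \<alpha>_def)
  have k: "k > 0" using \<alpha> P D_pos by (simp add: k_def add_pos_pos)
  have P\<alpha>: "P = 8 * D * \<alpha> * r0\<^sup>2" using D_pos r0 by (simp add: \<alpha>_def)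
  have \<rho>T: "\<rho> T = r" using \<tau> by (simp add: \<rho>_def \<sigma>_def)
  have \<rho>: "r0 \<le> \<rho> s \<and> \<rho> s \<le> r" if "\<tau> \<le> s" "s \<le> T" for s
  proof -
    have "\<sigma> * (s - \<tau>) \<le> \<sigma> * (T - \<tau>)" using \<sigma> that by (intro mult_left_mono) auto
    then show ?thesis using \<rho>T \<sigma> that by (simp add: \<rho>_def)
  qed
  have "continuous_on {0..r0} (w \<tau>)"
    by (rule continuous_on_compose2[OF w_cont, of _ "\<lambda>x. (\<tau>, x)", simplified])
      (use \<tau> in \<open>auto intro!: continuous_intros\<close>)
  then obtain x0 where x0: "x0 \<in> {0..r0}" "\<And>x. x \<in> {0..r0} \<Longrightarrow> w \<tau> x0 \<le> w \<tau> x"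
    using continuous_attains_inf[of "{0..r0}" "w \<tau>"] r0 by auto
  define V where "V = r\<^sup>2 + \<alpha> * (r\<^sup>2)\<^sup>2"
  have V: "V > 0" using r0 \<alpha> by (simp add: V_def add_pos_nonneg)
  define \<delta> where "\<delta> = min (w \<tau> x0) G / V"
  have \<delta>: "\<delta> > 0" using V G init[of x0] x0 by (simp add: \<delta>_def)
  have \<delta>V: "\<delta> * V = min (w \<tau> x0) G" using V by (simp add: \<delta>_def)
  define e where "e = (\<lambda>s. \<delta> * exp (- k * (s - \<tau>)))"
  have e: "0 < e s" for s using \<delta> by (simp add: e_def)
  have e_le: "e s \<le> \<delta>" if "\<tau> \<le> s" for s using \<delta> k that by (simp add: e_def)
  define y where "y = (\<lambda>s x. (\<rho> s)\<^sup>2 - x\<^sup>2)"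
  define z where "z = (\<lambda>s x. e s * (y s x + \<alpha> * (y s x)\<^sup>2))"
  define zt where "zt = (\<lambda>s x. e s * ((1 + 2 * \<alpha> * y s x) * (2 * \<rho> s * \<sigma>) - k * (y s x + \<alpha> * (y s x)\<^sup>2)))"
  define zx where "zx = (\<lambda>s x. e s * ((1 + 2 * \<alpha> * y s x) * (- 2 * x)))"
  define zxx where "zxx = (\<lambda>s x. e s * (- 2 * (1 + 2 * \<alpha> * y s x) + 8 * \<alpha> * x\<^sup>2))"
  have z_zx: "(z s has_real_derivative zx s x) (at x)" for s x
    unfolding z_def zx_def y_def by (auto intro!: derivative_eq_intros simp: algebra_simps)
  have zx_zxx: "(zx s has_real_derivative zxx s x) (at x)" for s x
    unfolding zx_def zxx_def y_def by (auto intro!: derivative_eq_intros simp: algebra_simps power2_eq_square)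
  have z_zt: "((\<lambda>s. z s x) has_real_derivative zt s x) (at s)" for s x
    unfolding z_def zt_def y_def \<rho>_def e_def
    by (auto intro!: derivative_eq_intros simp: algebra_simps)
  have y_bounds: "0 \<le> y s x \<and> y s x \<le> r\<^sup>2" if "\<tau> \<le> s" "s \<le> T" "0 \<le> x" "x \<le> \<rho> s" for s x
  proof -
    have "x\<^sup>2 \<le> (\<rho> s)\<^sup>2" "(\<rho> s)\<^sup>2 \<le> r\<^sup>2" using \<rho>[of s] that r0 by (auto intro!: power_mono)
    then show ?thesis by (simp add: y_def) (use zero_le_power2[of x] in linarith)
  qed
  have z_le: "z s x \<le> min (w \<tau> x0) G" if "\<tau> \<le> s" "s \<le> T" "0 \<le> x" "x \<le> \<rho> s" for s x
  proof -
    have "y s x + \<alpha> * (y s x)\<^sup>2 \<le> V"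
      unfolding V_def using y_bounds[OF that] \<alpha> by (intro add_mono mult_left_mono power_mono) auto
    then have "z s x \<le> \<delta> * V"
      unfolding z_def using e_le[OF that(1)] \<delta> y_bounds[OF that] \<alpha> by (intro mult_mono) auto
    then show ?thesis using \<delta>V by simp
  qed
  have sub: "zt s x - D * zxx s x \<le> 0" if s: "\<tau> \<le> s" "s \<le> T" "0 \<le> x" "x \<le> \<rho> s" for s x
  proof -
    let ?y = "y s x"
    have y: "?y \<ge> 0" using y_bounds[OF s] by simp
    have "2 * \<rho> s * \<sigma> + 2 * D \<le> P"
      unfolding P_def using \<rho>[OF s(1,2)] \<sigma> by (intro add_right_mono mult_right_mono) auto
    then have "(2 * \<rho> s * \<sigma> + 2 * D) * (1 + 2 * \<alpha> * ?y) \<le> P * (1 + 2 * \<alpha> * ?y)"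
      using y \<alpha> by (intro mult_right_mono) auto
    moreover have "8 * D * \<alpha> * r0\<^sup>2 \<le> 8 * D * \<alpha> * (x\<^sup>2 + ?y)"
      using \<rho>[OF s(1,2)] r0 D_pos \<alpha> by (intro mult_left_mono) (auto simp: y_def)
    moreover have "0 \<le> k * (\<alpha> * ?y\<^sup>2)" using k \<alpha> by simp
    moreover have "k * ?y = 2 * \<alpha> * P * ?y + 8 * D * \<alpha> * ?y" by (simp add: k_def algebra_simps)
    ultimately have "(2 * \<rho> s * \<sigma> + 2 * D) * (1 + 2 * \<alpha> * ?y) - 8 * D * \<alpha> * x\<^sup>2 - k * (?y + \<alpha> * ?y\<^sup>2) \<le> 0"
      using P\<alpha> by (simp add: algebra_simps)
    then have "e s * ((2 * \<rho> s * \<sigma> + 2 * D) * (1 + 2 * \<alpha> * ?y) - 8 * D * \<alpha> * x\<^sup>2 - k * (?y + \<alpha> * ?y\<^sup>2)) \<le> 0"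
      using e[of s] by (intro mult_nonneg_nonpos) auto
    then show ?thesis unfolding zt_def zxx_def by (simp add: algebra_simps)
  qed
  have le: "z T x \<le> w T x" if x: "0 \<le> x" "x \<le> r" for x
  proof -
    have "1 * (w T x - z T x) \<ge> 0"
    proof (rule comparison[where z = z and zt = zt and zx = zx and zxx = zxx and
          \<sigma> = 1 and \<tau> = \<tau> and T = T and l = "\<lambda>_. 0" and r = \<rho> and C = 0])
      show "continuous_on {\<tau>..T} \<rho>" unfolding \<rho>_def by (intro continuous_intros)
      show "continuous_on (strip \<tau> T (\<lambda>_. 0) \<rho>) (\<lambda>p. z (fst p) (snd p))"
        unfolding z_def y_def \<rho>_def e_def by (intro continuous_intros)
      show "(0::real) \<le> 0 \<and> \<rho> s \<le> \<eta> s" if "\<tau> \<le> s" "s \<le> T" for s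
        using \<rho>[OF that] r0 \<eta>_mono[of \<tau> s] \<tau> that by auto
      show "1 * (w \<tau> x - z \<tau> x) \<ge> 0" if "0 \<le> x" "x \<le> \<rho> \<tau>" for x
        using z_le[of \<tau> x] that x0(2)[of x] \<tau> by (auto simp: \<rho>_def)
      show "1 * (w s (\<rho> s) - z s (\<rho> s)) \<ge> 0" if "\<tau> < s" "s \<le> T" for s
        using nonneg[of s "\<rho> s"] \<rho>[of s] r0 that \<tau> by (simp add: z_def y_def)
      show "1 * (w s 0 - z s 0) \<ge> 0 \<or> 0 = (0::real) \<and> 1 * zx s 0 \<ge> 0" for s
        by (simp add: zx_def)
    next
      fix s x assume s: "\<tau> < s" "s \<le> T" "0 < x" "x < \<rho> s" "1 * (w s x - z s x) < 0"
      have "w s x * (A - w s x - B * q s x) \<ge> 0"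
        using s z_le[of s x] G(2)[of s x] nonneg[of s x] \<tau> by (intro mult_nonneg_nonneg) auto
      then show "0 * (1 * (w s x - z s x)) \<le> 1 * (w s x * (A - w s x - B * q s x) - (zt s x - D * zxx s x))"
        using sub[of s x] s by simp
    qed (use \<tau> x \<rho>T z_zx zx_zxx z_zt in auto)
    then show ?thesis by simp
  qed
  show ?thesis
  proof (intro exI[of _ "e T"] conjI ballI)
    fix x assume x: "x \<in> {0..r}"
    have "e T * (r\<^sup>2 - x\<^sup>2) \<le> z T x"
      unfolding z_def using e[of T] \<alpha> by (intro mult_left_mono) (auto simp: y_def \<rho>T)
    also have "\<dots> \<le> w T x" using le x by simp
    finally show "e T * (r\<^sup>2 - x\<^sup>2) \<le> w T x" .
  qed (rule e)
qed

lemma spreading: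
  assumes G: "G > 0" "\<And>t x. 0 \<le> t \<Longrightarrow> 0 \<le> x \<Longrightarrow> G \<le> A - B * q t x"
    and init: "\<And>x. 0 \<le> x \<Longrightarrow> x < \<eta> 0 \<Longrightarrow> w 0 x > 0"
    and large: "pi / 2 \<le> sqrt (G / D) * \<eta> 0"
  shows "filterlim \<eta> at_top at_top"
proof -
  have \<eta>0: "\<eta> 0 > 0" by (rule \<eta>_pos) simp
  have early: "\<exists>m>0. \<forall>x\<in>{0..\<eta> 0}. m * ((\<eta> 0)\<^sup>2 - x\<^sup>2) \<le> w t x" if "t > 0" for t
    using that \<eta>0 init G by (intro positivity_spreads[of 0 t "\<eta> 0 / 2" "\<eta> 0" G]) auto
  have \<eta>1: "\<eta> 0 < \<eta> 1"
  proof (rule ccontr)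
    assume "\<not> \<eta> 0 < \<eta> 1"
    then have const: "\<eta> t = \<eta> 0" if "0 \<le> t" "t \<le> 1" for t
      using \<eta>_mono[of 0 t] \<eta>_mono[of t 1] that by simp
    have "(\<eta> has_real_derivative 0) (at (1/2))"
    proof (rule has_field_derivative_transform_within[of "\<lambda>_. \<eta> 0" _ _ _ "1/2"])
      show "\<eta> 0 = \<eta> t" if "dist t (1/2) < 1/2" for t
        using const[of t] that by (simp add: dist_real_def abs_if split: if_splits)
    qed auto
    then have \<eta>'0: "\<eta>' (1/2) = 0" using DERIV_unique[OF \<eta>_deriv[of "1/2"]] by simp
    obtain m where m: "m > 0" "\<forall>x\<in>{0..\<eta> 0}. m * ((\<eta> 0)\<^sup>2 - x\<^sup>2) \<le> w (1/2) x"
      using early[of "1/2"] by auto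
    have "wx (1/2) (\<eta> (1/2)) \<le> - (2 * m * \<eta> 0)"
    proof (rule wx_le_at_front[of _ 0 "\<lambda>x. m * ((\<eta> 0)\<^sup>2 - x\<^sup>2)"])
      show "((\<lambda>x. m * ((\<eta> 0)\<^sup>2 - x\<^sup>2)) has_real_derivative - (2 * m * \<eta> 0)) (at (\<eta> (1/2)))"
        using const[of "1/2"] by (auto intro!: derivative_eq_intros)
    qed (use m \<eta>0 const[of "1/2"] in auto)
    also have "\<dots> < 0" using m \<eta>0 by simp
    finally have "\<kappa> * wx (1/2) (\<eta> (1/2)) < 0" using \<kappa>_pos by (simp add: mult_pos_neg)
    then show False using stefan[of "1/2"] \<eta>'0 by auto
  qed
  obtain m1 where m1: "m1 > 0" "\<forall>x\<in>{0..\<eta> 0}. m1 * ((\<eta> 0)\<^sup>2 - x\<^sup>2) \<le> w 1 x"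
    using early[of 1] by auto
  have "w 1 x > 0" if "0 \<le> x" "x \<le> \<eta> 0 / 2" for x
  proof -
    have "x\<^sup>2 < (\<eta> 0)\<^sup>2" using that \<eta>0 by (intro power_strict_mono) auto
    then have "0 < m1 * ((\<eta> 0)\<^sup>2 - x\<^sup>2)" using m1 by simp
    then show ?thesis using m1(2) that \<eta>0 by force
  qed
  then obtain m2 where m2: "m2 > 0" "\<forall>x\<in>{0..\<eta> 1}. m2 * ((\<eta> 1)\<^sup>2 - x\<^sup>2) \<le> w 2 x"
    using positivity_spreads[of 1 2 "\<eta> 0 / 2" "\<eta> 1" G] \<eta>0 \<eta>1 G by auto
  obtain r where r: "\<eta> 0 < r" "r < \<eta> 1" using \<eta>1 dense by blast
  define \<omega>0 where "\<omega>0 = sqrt (G / D)"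
  have \<omega>0: "\<omega>0 > 0" "D * \<omega>0\<^sup>2 = G" using G D_pos by (auto simp: \<omega>0_def)
  have "pi / 2 < \<omega>0 * r"
    using large mult_strict_left_mono[OF r(1) \<omega>0(1)] unfolding \<omega>0_def by linarith
  then have "pi / (2 * r) < min \<omega>0 (pi / r)" using r \<eta>0 by (simp add: field_simps)
  from dense[OF this] obtain \<omega> where \<omega>: "pi / (2 * r) < \<omega>" "\<omega> < \<omega>0" "\<omega> < pi / r"
    by auto
  have rpos: "r > 0" using r \<eta>0 by simp
  have \<omega>pos: "\<omega> > 0" using \<omega>(1) rpos less_trans[of 0 "pi / (2 * r)" \<omega>] by simp
  have \<omega>r: "pi / 2 < \<omega> * r" "\<omega> * r < pi" using \<omega> rpos by (auto simp: field_simps)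
  have "D * \<omega>\<^sup>2 < G" using \<omega>0 \<omega> \<omega>pos D_pos by (auto simp flip: \<omega>0(2) intro!: power_strict_mono)
  define \<epsilon> where "\<epsilon> = (G - D * \<omega>\<^sup>2) / 2"
  have \<epsilon>: "\<epsilon> > 0" using \<open>D * \<omega>\<^sup>2 < G\<close> by (simp add: \<epsilon>_def)
  define \<delta> where "\<delta> = min \<epsilon> (m2 * ((\<eta> 1)\<^sup>2 - r\<^sup>2))"
  have "r\<^sup>2 < (\<eta> 1)\<^sup>2" using r rpos by (intro power_strict_mono) auto
  then have \<delta>: "\<delta> > 0" using \<epsilon> m2 by (simp add: \<delta>_def)
  define c0 where "c0 = cos (pi - \<omega> * r)"
  have c0: "c0 > 0" unfolding c0_def using \<omega>r by (intro cos_gt_zero) auto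
  define E where "E = exp (- (1 / (2 * D)) * (pi / \<omega>))"
  define b where "b = min (min 1 (4 * D * \<epsilon>)) (min (2 * D * \<omega> * c0) (\<kappa> * (\<delta> * \<omega> * E)))"
  have "b > 0" using D_pos \<epsilon> \<omega>pos c0 \<kappa>_pos \<delta> by (simp add: b_def E_def)
  then obtain \<sigma> where \<sigma>: "0 < \<sigma>" "\<sigma> < b" using dense by blast
  have bound: "r - pi / \<omega> + pi / \<omega> + \<sigma> * (t - 2) < \<eta> t" if "2 \<le> t" for t
  proof (rule front_bound[where \<delta> = \<delta> and G = G])
    show "r - pi / \<omega> + pi / \<omega> < \<eta> 2" using r \<eta>_mono[of 1 2] by simp
    show "\<delta> \<le> w 2 x" if "0 \<le> x" "x \<le> r - pi / \<omega> + pi / \<omega>" for x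
    proof -
      have "x\<^sup>2 \<le> r\<^sup>2" using that by (intro power_mono) auto
      then have "m2 * ((\<eta> 1)\<^sup>2 - r\<^sup>2) \<le> m2 * ((\<eta> 1)\<^sup>2 - x\<^sup>2)" using m2 by (intro mult_left_mono) auto
      also have "\<dots> \<le> w 2 x" using m2 that r by auto
      finally show ?thesis by (simp add: \<delta>_def)
    qed
    have "\<sigma> * \<sigma> \<le> \<sigma> * 1" using \<sigma> by (intro mult_left_mono) (auto simp: b_def)
    also have "\<dots> \<le> 4 * D * \<epsilon>" using \<sigma> by (simp add: b_def)
    finally have "\<sigma>\<^sup>2 / (4 * D) \<le> \<epsilon>" using D_pos by (simp add: field_simps power2_eq_square)
    moreover have "\<delta> \<le> \<epsilon>" by (simp add: \<delta>_def)
    moreover have "D * \<omega>\<^sup>2 + \<epsilon> + \<epsilon> = G" by (simp add: \<epsilon>_def field_simps)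
    ultimately show "D * \<omega>\<^sup>2 + \<sigma>\<^sup>2 / (4 * D) + \<delta> \<le> G" by linarith
    show "\<sigma> / (2 * D) * sin (\<omega> * \<xi>) \<le> \<omega> * cos (\<omega> * \<xi>)" if "0 \<le> \<xi>" "\<xi> \<le> - (r - pi / \<omega>)" for \<xi>
    proof -
      have "\<omega> * \<xi> \<le> \<omega> * (pi / \<omega> - r)" using that \<omega>pos by (intro mult_left_mono) auto
      then have "\<omega> * \<xi> \<le> pi - \<omega> * r" using \<omega>pos by (simp add: algebra_simps)
      then have "c0 \<le> cos (\<omega> * \<xi>)"
        unfolding c0_def using that \<omega>pos \<omega>r by (intro cos_monotone_0_pi_le) auto
      then have "\<omega> * c0 \<le> \<omega> * cos (\<omega> * \<xi>)" using \<omega>pos by (intro mult_left_mono) auto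
      moreover have "\<sigma> / (2 * D) * sin (\<omega> * \<xi>) \<le> \<sigma> / (2 * D) * 1"
        using \<sigma> D_pos by (intro mult_left_mono) auto
      moreover have "\<sigma> / (2 * D) \<le> \<omega> * c0" using \<sigma> D_pos by (simp add: b_def field_simps)
      ultimately show ?thesis by linarith
    qed
    have "\<sigma> / (2 * D) \<le> 1 / (2 * D)" using \<sigma> D_pos by (intro divide_right_mono) (auto simp: b_def)
    then have "\<sigma> / (2 * D) * (pi / \<omega>) \<le> 1 / (2 * D) * (pi / \<omega>)"
      using \<omega>pos by (intro mult_right_mono) auto
    then have "E \<le> exp (- (\<sigma> / (2 * D)) * (pi / \<omega>))" unfolding E_def by simp
    then have "\<kappa> * (\<delta> * \<omega> * E) \<le> \<kappa> * (\<delta> * \<omega> * exp (- (\<sigma> / (2 * D)) * (pi / \<omega>)))"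
      using \<kappa>_pos \<delta> \<omega>pos by (intro mult_left_mono) auto
    then show "\<sigma> < \<kappa> * (\<delta> * \<omega> * exp (- (\<sigma> / (2 * D)) * (pi / \<omega>)))"
      using \<sigma> by (simp add: b_def)
  qed (use G \<omega>pos \<sigma> \<delta> rpos that in auto)
  have "filterlim (\<lambda>t. r + \<sigma> * (t - 2)) at_top at_top"
    by (rule filterlim_linear_at_top) (rule \<sigma>)
  moreover have "eventually (\<lambda>t. r + \<sigma> * (t - 2) \<le> \<eta> t) at_top"
    using eventually_ge_at_top[of 2] by eventually_elim (use bound in force)
  ultimately show ?thesis by (rule filterlim_at_top_mono)
qed

end

lemma fb_solution_species:
  assumes sol: "fb_solution d a b c \<beta> \<mu> g0 h0 u0 v0 u v g h"
    and pos: "d > 0" "\<beta> > 0" "\<mu> > 0" "g0 > 0" "h0 > 0"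
    and init: "\<And>x. x \<ge> 0 \<Longrightarrow> u0 x \<ge> 0" "\<And>x. x \<ge> 0 \<Longrightarrow> v0 x \<ge> 0"
  obtains ut ux uxx g' vt vx vxx h' where
    "fb_species d a b \<beta> u v ut ux uxx g g'" "fb_species 1 1 (- c) \<mu> v u vt vx vxx h h'"
proof -
  have g_pos: "g t > 0" and h_pos: "h t > 0" if "t \<ge> 0" for t
    using sol pos that by (cases "t = 0"; auto simp: fb_solution_def)+
  from sol[unfolded fb_solution_def] obtain ut ux uxx g' vt vx vxx h' where
    U: "\<forall>t>0. (g has_real_derivative g' t) (at t) \<and>
        (\<forall>x\<in>{0..g t}. ((\<lambda>y. u t y) has_real_derivative ux t x) (at x within {0..g t})) \<and>
        (\<forall>x\<in>{0<..<g t}. ((\<lambda>s. u s x) has_real_derivative ut t x) (at t) \<and>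
                          (ux t has_real_derivative uxx t x) (at x) \<and>
                          ut t x - d * uxx t x = u t x * (a - u t x - b * v t x)) \<and>
        ux t 0 = 0 \<and> g' t = - \<beta> * ux t (g t)"
    and V: "\<forall>t>0. (h has_real_derivative h' t) (at t) \<and>
        (\<forall>x\<in>{0..h t}. ((\<lambda>y. v t y) has_real_derivative vx t x) (at x within {0..h t})) \<and>
        (\<forall>x\<in>{0<..<h t}. ((\<lambda>s. v s x) has_real_derivative vt t x) (at t) \<and>
                          (vx t has_real_derivative vxx t x) (at x) \<and>
                          vt t x - vxx t x = v t x * (1 - v t x + c * u t x)) \<and>
        vx t 0 = 0 \<and> h' t = - \<mu> * vx t (h t)"
    by (elim conjE exE) (rule that)
  have "fb_species d a b \<beta> u v ut ux uxx g g'"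
    by unfold_locales (use sol pos init U g_pos in \<open>auto simp: fb_solution_def\<close>)
  moreover have "fb_species 1 1 (- c) \<mu> v u vt vx vxx h h'"
    by unfold_locales (use sol pos init V h_pos in \<open>auto simp: fb_solution_def\<close>)
  ultimately show ?thesis by (rule that)
qed

lemma bdd_above_compactly_supported:
  fixes f :: "real \<Rightarrow> real"
  assumes "continuous_on {0..r} f" "\<And>x. x \<ge> r \<Longrightarrow> f x = 0"
  shows "bdd_above ((\<lambda>x. \<bar>f x\<bar>) ` {0..})"
proof -
  have "bounded (f ` {0..r})" using assms(1) by (intro compact_imp_bounded compact_continuous_image) auto
  then obtain C where C: "\<And>x. x \<in> {0..r} \<Longrightarrow> \<bar>f x\<bar> \<le> C" by (force simp: bounded_iff)
  have "\<bar>f x\<bar> \<le> max C 0" if "x \<ge> 0" for x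
    using C[of x] assms(2)[of x] that by (cases "x \<le> r") auto
  then show ?thesis by (auto intro!: bdd_aboveI2[where M = "max C 0"])
qed

lemma C2_with_continuous:
  assumes "C2_with S f f' f''"
  shows "continuous_on S f" "continuous_on S f'"
  using assms by (auto simp: C2_with_def intro: DERIV_continuous_on)

theorem theorem5p4:
  fixes a b c d \<beta> g0 h0 :: real
    and u0 u0' u0'' v0 v0' v0'' :: "real \<Rightarrow> real"
  assumes pos: "a > 0" "b > 0" "c > 0" "d > 0" "\<beta> > 0"
    and hg: "0 < h0" "h0 \<le> g0"
    and u0C2: "C2_with {0..g0} u0 u0' u0''" and u0d0: "u0' 0 = 0"
    and u0pos: "\<forall>x\<in>{0..<g0}. u0 x > 0" and u0zero: "\<forall>x\<ge>g0. u0 x = 0"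
    and v0C2: "C2_with {0..h0} v0 v0' v0''" and v0d0: "v0' 0 = 0"
    and v0pos: "\<forall>x\<in>{0..<h0}. v0 x > 0" and v0zero: "\<forall>x\<ge>h0. v0 x = 0"
  defines "M1 \<equiv> max a (SUP x\<in>{0..}. \<bar>u0 x\<bar>)"
  defines "M2 \<equiv> max (1 + c * M1) (SUP x\<in>{0..}. \<bar>v0 x\<bar>)"
  defines "K \<equiv> 2 * max (M2 * sqrt ((1 + c * M1) / 2)) (- (INF x\<in>{0..h0}. v0' x))"
  defines "L \<equiv> (\<lambda>\<mu>::real. 2 * d * pi / sqrt (2 * d * a - K\<^sup>2 * \<mu>\<^sup>2))"
  shows "(\<exists>\<mu>bar. 0 < \<mu>bar \<and> \<mu>bar < sqrt (2 * d * a) / K \<and>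
           (\<forall>\<mu> u v g h. 0 < \<mu> \<and> \<mu> < \<mu>bar \<and> g0 - h0 > L \<mu> \<and>
               fb_solution d a b c \<beta> \<mu> g0 h0 u0 v0 u v g h \<longrightarrow>
               (\<forall>t\<ge>0. g t \<ge> K * \<mu> * t + h0 + L \<mu>) \<and>
               (\<forall>t\<ge>0. g t > h t) \<and>
               filterlim g at_top at_top))
       \<and> (h0 \<ge> pi / 2 \<longrightarrow>
           (\<forall>\<mu> u v g h. \<mu> > 0 \<and> fb_solution d a b c \<beta> \<mu> g0 h0 u0 v0 u v g h \<longrightarrow>
               filterlim h at_top at_top))"
proof -
  have M1_ge: "a \<le> M1" "M1 > 0" using pos by (auto simp: M1_def)
  have u0_nonneg: "u0 x \<ge> 0" if "x \<ge> 0" for x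
    using u0pos u0zero that by (cases "x < g0") (auto simp: less_imp_le)
  have v0_nonneg: "v0 x \<ge> 0" if "x \<ge> 0" for x
    using v0pos v0zero that by (cases "x < h0") (auto simp: less_imp_le)
  have u0_le: "u0 x \<le> M1" if "x \<ge> 0" for x
  proof -
    have "\<bar>u0 x\<bar> \<le> (SUP x\<in>{0..}. \<bar>u0 x\<bar>)"
      by (intro cSUP_upper bdd_above_compactly_supported[of g0])
        (use that u0zero C2_with_continuous(1)[OF u0C2] in auto)
    then show ?thesis by (simp add: M1_def)
  qed
  have v0_le: "v0 x \<le> M2" if "x \<ge> 0" for x
  proof -
    have "\<bar>v0 x\<bar> \<le> (SUP x\<in>{0..}. \<bar>v0 x\<bar>)"
      by (intro cSUP_upper bdd_above_compactly_supported[of h0])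
        (use that v0zero C2_with_continuous(1)[OF v0C2] in auto)
    then show ?thesis by (simp add: M2_def)
  qed
  have N: "1 + c * M1 > 0" using pos M1_ge by (simp add: add_pos_pos)
  have M2: "1 + c * M1 \<le> M2" "M2 > 0" using N by (auto simp: M2_def)
  define M where "M = K / (2 * M2)"
  have K2: "K = 2 * M2 * M" using M2 by (simp add: M_def)
  have K_ge: "K \<ge> 2 * (M2 * sqrt ((1 + c * M1) / 2))" by (simp add: K_def)
  have "2 * M2 * sqrt ((1 + c * M1) / 2) \<le> 2 * M2 * M" using K_ge K2 by simp
  then have M_ge: "sqrt ((1 + c * M1) / 2) \<le> M" using M2 by simp
  have M: "M > 0" using less_le_trans[OF _ M_ge] N by simp
  have K: "K > 0" using K2 M M2 by simp
  have "(sqrt ((1 + c * M1) / 2))\<^sup>2 \<le> M\<^sup>2" using M_ge N by (intro power_mono) auto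
  then have M_sq: "1 + c * M1 \<le> 2 * 1 * M\<^sup>2" using N by simp
  have v0_lin: "v0 x \<le> M2 * M * (h0 - x)" if x: "0 \<le> x" "x \<le> h0" for x
  proof (cases "x = h0")
    case False
    have "bounded (v0' ` {0..h0})"
      using C2_with_continuous(2)[OF v0C2] by (intro compact_imp_bounded compact_continuous_image) auto
    then have bdd: "bdd_below (v0' ` {0..h0})" by (rule bounded_imp_bdd_below)
    have at: "(v0 has_real_derivative v0' y) (at y)" if "0 < y" "y < h0" for y
      using v0C2 that by (auto simp: C2_with_def at_within_Icc_at dest!: bspec[of _ _ y])
    have "continuous_on {x..h0} v0"
      using C2_with_continuous(1)[OF v0C2] by (rule continuous_on_subset) (use x in auto)
    then obtain m y where "x < y" "y < h0" "(v0 has_real_derivative m) (at y)" "v0 h0 - v0 x = (h0 - x) * m"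
      using MVT[of x h0 v0] at x False by (metis order_le_less_trans order_less_le real_differentiable_def)
    then have y: "y \<in> {x<..<h0}" "v0 h0 - v0 x = (h0 - x) * v0' y"
      using DERIV_unique[OF _ at[of y]] x by auto
    have "(INF x\<in>{0..h0}. v0' x) \<le> v0' y" using bdd y x by (intro cINF_lower) auto
    moreover have "2 * - (INF x\<in>{0..h0}. v0' x) \<le> K" by (simp add: K_def)
    ultimately have "- v0' y \<le> M2 * M" using K2 by simp
    then have "(h0 - x) * (- v0' y) \<le> (h0 - x) * (M2 * M)" using x by (intro mult_left_mono) auto
    then show ?thesis using y v0zero by (simp add: algebra_simps)
  qed (use v0zero in auto)

  have second: "filterlim h at_top at_top"
    if "h0 \<ge> pi / 2" "\<mu> > 0" and sol: "fb_solution d a b c \<beta> \<mu> g0 h0 u0 v0 u v g h" for \<mu> u v g h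
  proof -
    obtain ut ux uxx g' vt vx vxx h' where
      "fb_species d a b \<beta> u v ut ux uxx g g'" "fb_species 1 1 (- c) \<mu> v u vt vx vxx h h'"
      using fb_solution_species[OF sol] pos hg \<open>\<mu> > 0\<close> u0_nonneg v0_nonneg by (metis less_le_trans)
    then interpret U: fb_species d a b \<beta> u v ut ux uxx g g' + V: fb_species 1 1 "- c" \<mu> v u vt vx vxx h h' .
    have "h 0 = h0" "\<And>x. x \<ge> 0 \<Longrightarrow> v 0 x = v0 x" using sol by (auto simp: fb_solution_def)
    then show ?thesis
      using U.nonneg pos v0pos \<open>h0 \<ge> pi / 2\<close> by (intro V.spreading[of 1]) auto
  qed

  have h_le: "h t \<le> h0 + K * \<mu> * t"
    if "\<mu> > 0" "t \<ge> 0" and sol: "fb_solution d a b c \<beta> \<mu> g0 h0 u0 v0 u v g h" for \<mu> u v g h t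
  proof -
    obtain ut ux uxx g' vt vx vxx h' where
      "fb_species d a b \<beta> u v ut ux uxx g g'" "fb_species 1 1 (- c) \<mu> v u vt vx vxx h h'"
      using fb_solution_species[OF sol] pos hg \<open>\<mu> > 0\<close> u0_nonneg v0_nonneg by (metis less_le_trans)
    then interpret U: fb_species d a b \<beta> u v ut ux uxx g g' + V: fb_species 1 1 "- c" \<mu> v u vt vx vxx h h' .
    have init: "h 0 = h0" "\<And>x. x \<ge> 0 \<Longrightarrow> v 0 x = v0 x" "\<And>x. x \<ge> 0 \<Longrightarrow> u 0 x = u0 x"
      using sol by (auto simp: fb_solution_def)
    have "a - b * v t x \<le> M1" if "t \<ge> 0" "x \<ge> 0" for t x
    proof -
      have "0 \<le> b * v t x" using V.nonneg[OF that] pos by simp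
      then show ?thesis using M1_ge by linarith
    qed
    then have u_le: "u t x \<le> M1" if "t \<ge> 0" "x \<ge> 0" for t x
      by (rule U.le_bound[rotated 2]) (use that M1_ge init u0_le in auto)
    have cu: "1 - - c * u t x \<le> 1 + c * M1" if "t \<ge> 0" "x \<ge> 0" for t x
      using u_le[OF that] pos by (simp add: mult_left_mono)
    have "v t x \<le> M2" if "t \<ge> 0" "x \<ge> 0" for t x
      by (rule V.le_bound) (use that M2 init v0_le order_trans[OF cu M2(1)] in auto)
    then have "h' t \<le> \<mu> * (2 * M2 * M)" if "t > 0" for t
      by (rule V.\<eta>'_le[where N = "1 + c * M1", rotated]) (use that M2 N cu M M_sq init v0_lin in auto)
    then have "h t \<le> h 0 + \<mu> * (2 * M2 * M) * t" using \<open>t \<ge> 0\<close> by (intro V.\<eta>_le_linear) auto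
    then show ?thesis using init K2 by (simp add: algebra_simps)
  qed

  have first: "(\<forall>t\<ge>0. g t \<ge> K * \<mu> * t + h0 + L \<mu>) \<and> (\<forall>t\<ge>0. g t > h t) \<and> filterlim g at_top at_top"
    if \<mu>: "\<mu> > 0" "K\<^sup>2 * \<mu>\<^sup>2 < 2 * d * a" "L \<mu> < g0 - h0"
      and sol: "fb_solution d a b c \<beta> \<mu> g0 h0 u0 v0 u v g h"
      and \<delta>: "0 < \<delta>" "\<delta> \<le> a / 2" "\<And>x. h0 \<le> x \<Longrightarrow> x \<le> h0 + L \<mu> \<Longrightarrow> \<delta> \<le> u0 x"
      and speed: "K * \<mu> < \<beta> * (\<delta> * (pi / L \<mu>) * exp (- (K * \<mu> / (2 * d)) * L \<mu>))"
    for \<mu> u v g h \<delta>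
  proof -
    obtain ut ux uxx g' vt vx vxx h' where
      "fb_species d a b \<beta> u v ut ux uxx g g'" "fb_species 1 1 (- c) \<mu> v u vt vx vxx h h'"
      using fb_solution_species[OF sol] pos hg \<open>\<mu> > 0\<close> u0_nonneg v0_nonneg by (metis less_le_trans)
    then interpret U: fb_species d a b \<beta> u v ut ux uxx g g' + V: fb_species 1 1 "- c" \<mu> v u vt vx vxx h h' .
    have init: "g 0 = g0" "\<And>x. x \<ge> 0 \<Longrightarrow> u 0 x = u0 x" using sol by (auto simp: fb_solution_def)
    define \<omega> where "\<omega> = sqrt (2 * d * a - K\<^sup>2 * \<mu>\<^sup>2) / (2 * d)"
    have \<omega>: "\<omega> > 0" using \<mu> pos by (simp add: \<omega>_def)
    have L\<omega>: "L \<mu> = pi / \<omega>" using pos by (simp add: L_def \<omega>_def field_simps)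
    have "\<omega>\<^sup>2 = (2 * d * a - K\<^sup>2 * \<mu>\<^sup>2) / (4 * d\<^sup>2)"
      using \<mu> by (simp add: \<omega>_def power_divide power_mult_distrib)
    then have eq: "d * \<omega>\<^sup>2 + (K * \<mu>)\<^sup>2 / (4 * d) = a / 2"
      using pos by (simp add: field_simps power2_eq_square)
    have main: "h0 + pi / \<omega> + K * \<mu> * (t - 0) < g t" if "t \<ge> 0" for t
    proof (rule U.front_bound[where \<delta> = \<delta> and G = a])
      show "a \<le> a - b * v t x" if "0 < t" "h0 + K * \<mu> * (t - 0) < x" for t x
        using h_le[OF \<mu>(1) _ sol, of t] V.w_zero[of t x] that by simp
      show "K * \<mu> < \<beta> * (\<delta> * \<omega> * exp (- (K * \<mu> / (2 * d)) * (pi / \<omega>)))"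
        using speed \<omega> by (simp add: L\<omega>)
      show "\<delta> \<le> u 0 x" if "0 \<le> x" "h0 \<le> x" "x \<le> h0 + pi / \<omega>" for x
        using \<delta>(3)[of x] that init by (simp add: L\<omega>)
    qed (use \<omega> \<delta> eq hg K \<mu> init that L\<omega> in \<open>auto simp: add_pos_pos\<close>)
    have "filterlim (\<lambda>t. h0 + pi / \<omega> + K * \<mu> * (t - 0)) at_top at_top"
      using K \<mu> by (intro filterlim_linear_at_top) auto
    moreover have "eventually (\<lambda>t. h0 + pi / \<omega> + K * \<mu> * (t - 0) \<le> g t) at_top"
      using eventually_ge_at_top[of 0] by eventually_elim (use main in force)
    ultimately have "filterlim g at_top at_top" by (rule filterlim_at_top_mono)
    moreover have "h t < g t" if "t \<ge> 0" for t
    proof -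
      have "pi / \<omega> > 0" using \<omega> by simp
      then show ?thesis using main[OF that] h_le[OF \<mu>(1) that sol] by simp
    qed
    moreover have "K * \<mu> * t + h0 + L \<mu> \<le> g t" if "t \<ge> 0" for t
      using main[OF that] by (simp add: L\<omega>)
    ultimately show ?thesis by blast
  qed

  have L_mono: "L s \<le> L t" if "0 \<le> s" "s \<le> t" "K\<^sup>2 * t\<^sup>2 < 2 * d * a" for s t
  proof -
    have "K\<^sup>2 * s\<^sup>2 \<le> K\<^sup>2 * t\<^sup>2" using that by (intro mult_left_mono power_mono) auto
    then show ?thesis unfolding L_def using that pos by (intro divide_left_mono) auto
  qed
  have da: "d * a > 0" "2 * d * a > 0" using pos by simp_all
  have below: "K\<^sup>2 * \<mu>\<^sup>2 < 2 * d * a" if "0 \<le> \<mu>" "\<mu> < sqrt (2 * d * a) / K" for \<mu>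
  proof -
    have "K * \<mu> < sqrt (2 * d * a)" using that K by (simp add: field_simps)
    then have "(K * \<mu>)\<^sup>2 < (sqrt (2 * d * a))\<^sup>2" using that K by (intro power_strict_mono) auto
    then show ?thesis using da by (simp add: power_mult_distrib real_sqrt_pow2)
  qed
  show ?thesis
  proof (intro conjI impI allI)
    show "\<exists>\<mu>bar. 0 < \<mu>bar \<and> \<mu>bar < sqrt (2 * d * a) / K \<and>
           (\<forall>\<mu> u v g h. 0 < \<mu> \<and> \<mu> < \<mu>bar \<and> g0 - h0 > L \<mu> \<and>
               fb_solution d a b c \<beta> \<mu> g0 h0 u0 v0 u v g h \<longrightarrow>
               (\<forall>t\<ge>0. g t \<ge> K * \<mu> * t + h0 + L \<mu>) \<and>
               (\<forall>t\<ge>0. g t > h t) \<and>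
               filterlim g at_top at_top)"
    proof (cases "L 0 < g0 - h0")
      case False
      define \<mu>bar where "\<mu>bar = sqrt (2 * d * a) / K / 2"
      have "0 < sqrt (2 * d * a) / K" using K da by simp
      then have \<mu>bar: "0 < \<mu>bar" "\<mu>bar < sqrt (2 * d * a) / K" by (auto simp: \<mu>bar_def)
      have vacuous: "\<not> L \<mu> < g0 - h0" if "0 < \<mu>" "\<mu> < \<mu>bar" for \<mu>
        using L_mono[of 0 \<mu>] below[of \<mu>] that \<mu>bar False by auto
      show ?thesis
        by (intro exI[of _ \<mu>bar] conjI[OF \<mu>bar(1)] conjI[OF \<mu>bar(2)] allI impI, elim conjE)
          (rule notE[OF vacuous])
    next
      case True
      have L0: "L 0 > 0" using pos by (simp add: L_def)
      define \<theta> where "\<theta> = 2 * d * pi / (g0 - h0)"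
      have gh: "g0 - h0 > 0" using True L0 by simp
      have \<theta>0: "\<theta> > 0" using gh pos by (simp add: \<theta>_def)
      have swap: "x / y < z" if "x / z < y" "y > 0" "z > 0" for x y z :: real
        using that by (simp add: field_simps)
      have "\<theta> < sqrt (2 * d * a)"
        unfolding \<theta>_def by (rule swap) (use True gh da in \<open>simp_all add: L_def\<close>)
      then have "\<theta>\<^sup>2 < (sqrt (2 * d * a))\<^sup>2" using \<theta>0 by (intro power_strict_mono) auto
      then have \<theta>: "\<theta>\<^sup>2 < 2 * d * a" using da by (simp add: real_sqrt_pow2)
      define n where "n = (2 * d * a - \<theta>\<^sup>2) / 2"
      have half: "0 < (x - y) / 2 \<and> (x - y) / 2 < x \<and> y < x - (x - y) / 2" if "0 \<le> y" "y < x" for x y :: real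
        using that by (auto simp: field_simps)
      have n: "n > 0" and n_less: "n < 2 * d * a" and n_\<theta>: "\<theta>\<^sup>2 < 2 * d * a - n"
        using half[OF zero_le_power2 \<theta>] unfolding n_def by blast+
      define \<mu>1 where "\<mu>1 = sqrt n / K"
      have \<mu>1: "\<mu>1 > 0" using n K by (simp add: \<mu>1_def)
      have "K * \<mu>1 = sqrt n" using K by (simp add: \<mu>1_def)
      then have "(K * \<mu>1)\<^sup>2 = n" using n by simp
      then have K\<mu>1: "K\<^sup>2 * \<mu>1\<^sup>2 = n" by (simp add: power_mult_distrib)
      have \<theta>s: "\<theta> < sqrt (2 * d * a - K\<^sup>2 * \<mu>1\<^sup>2)"
        unfolding K\<mu>1 using n_\<theta> by (rule real_less_rsqrt)
      have root_pos: "0 < sqrt (2 * d * a - K\<^sup>2 * \<mu>1\<^sup>2)" using \<theta>0 \<theta>s by (rule less_trans)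
      have L1: "L \<mu>1 < g0 - h0"
        unfolding L_def using \<theta>s[unfolded \<theta>_def] root_pos gh by (rule swap)
      have L1_pos: "L \<mu>1 > 0" unfolding L_def using root_pos pos(4) by (intro divide_pos_pos mult_pos_pos pi_gt_zero) simp_all
      have "continuous_on {h0..h0 + L \<mu>1} u0"
        using C2_with_continuous(1)[OF u0C2] by (rule continuous_on_subset) (use hg L1 in auto)
      then obtain x0 where x0: "x0 \<in> {h0..h0 + L \<mu>1}" "\<And>x. x \<in> {h0..h0 + L \<mu>1} \<Longrightarrow> u0 x0 \<le> u0 x"
        using continuous_attains_inf[of "{h0..h0 + L \<mu>1}" u0] L1_pos by auto
      define \<delta> where "\<delta> = min (a / 2) (u0 x0)"
      have \<delta>: "\<delta> > 0" using pos u0pos x0(1) hg L1 by (auto simp: \<delta>_def)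
      define s where "s = \<beta> * (\<delta> * (pi / L \<mu>1) * exp (- (K * \<mu>1 / (2 * d)) * L \<mu>1))"
      have s: "s > 0" using pos \<delta> L1_pos by (simp add: s_def)
      define \<mu>bar where "\<mu>bar = min \<mu>1 (s / K)"
      have \<mu>bar: "0 < \<mu>bar" using \<mu>1 s K by (simp add: \<mu>bar_def)
      have "\<mu>1 < sqrt (2 * d * a) / K"
        unfolding \<mu>1_def using K n_less by (intro divide_strict_right_mono) auto
      then have \<mu>bar': "\<mu>bar < sqrt (2 * d * a) / K" by (simp add: \<mu>bar_def)
      have key: "(\<forall>t\<ge>0. g t \<ge> K * \<mu> * t + h0 + L \<mu>) \<and> (\<forall>t\<ge>0. g t > h t) \<and> filterlim g at_top at_top"
        if \<mu>: "0 < \<mu>" "\<mu> < \<mu>bar" "L \<mu> < g0 - h0" and sol: "fb_solution d a b c \<beta> \<mu> g0 h0 u0 v0 u v g h"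
        for \<mu> u v g h
      proof (rule first[where \<delta> = \<delta>, OF \<mu>(1) _ \<mu>(3) sol \<delta>])
        have \<mu>1': "\<mu> \<le> \<mu>1" using \<mu> by (simp add: \<mu>bar_def)
        show "K\<^sup>2 * \<mu>\<^sup>2 < 2 * d * a" using below[of \<mu>] \<mu> \<mu>bar' by simp
        then have "L \<mu> > 0" unfolding L_def using pos by (intro divide_pos_pos) auto
        have LL: "L \<mu> \<le> L \<mu>1" using L_mono[of \<mu> \<mu>1] \<mu> \<mu>1' K\<mu>1 n_less by simp
        show "\<delta> \<le> a / 2" by (simp add: \<delta>_def)
        show "\<delta> \<le> u0 x" if "h0 \<le> x" "x \<le> h0 + L \<mu>" for x
          using x0(2)[of x] that LL by (simp add: \<delta>_def)
        have "K * \<mu> < s" using \<mu> K by (simp add: \<mu>bar_def field_simps)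
        also have "s \<le> \<beta> * (\<delta> * (pi / L \<mu>) * exp (- (K * \<mu> / (2 * d)) * L \<mu>))"
        proof -
          have "K * \<mu> / (2 * d) * L \<mu> \<le> K * \<mu>1 / (2 * d) * L \<mu>1"
            using LL \<mu>1' \<mu> K pos \<open>L \<mu> > 0\<close> by (intro mult_mono divide_right_mono) auto
          moreover have "pi / L \<mu>1 \<le> pi / L \<mu>" using LL \<open>L \<mu> > 0\<close> by (intro divide_left_mono) auto
          ultimately show ?thesis
            unfolding s_def using pos \<delta> \<open>L \<mu> > 0\<close> by (intro mult_left_mono mult_mono) auto
        qed
        finally show "K * \<mu> < \<beta> * (\<delta> * (pi / L \<mu>) * exp (- (K * \<mu> / (2 * d)) * L \<mu>))" .
      qed
      show ?thesis
        by (intro exI[of _ \<mu>bar] conjI[OF \<mu>bar] conjI[OF \<mu>bar'] allI impI, elim conjE) (rule key)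
    qed
  next
    show "filterlim h at_top at_top"
      if "pi / 2 \<le> h0" "0 < \<mu> \<and> fb_solution d a b c \<beta> \<mu> g0 h0 u0 v0 u v g h" for \<mu> u v g h
      using second[OF that(1)] that(2) by blast
  qed
qed

end
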